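(* Let $G$ be a connected $\{1,3\}$-graph. Then the period of the Ehrhart quasi-polynomial $L^{\mathcal{P}}_G(t)$ is at most $2$ if $G$ is a tree or a cubic graph, and it is equal to $4$ otherwise.
   Context: A $\{1,3\}$-graph is a finite graph (loops and parallel edges allowed, a loop contributing $2$ to the degree) in which every node has degree $1$ or $3$; degree-$1$ nodes are leaves, degree-$3$ nodes are internal nodes; a cubic graph is one in which every node has degree 3. Let $E$ be the edge set. For each internal node $v$ let $a,b,c$ be the three edges incident with $v$, listed with multiplicity (a loop at $v$ is listed twice). The polytope $\mathcal{P}_G\subset\mathbb{R}^E$ is the set of $w$ satisfying, for every internal node $v$, $w_a\le w_b+w_c$, $w_b\le w_a+w_c$, $w_c\le w_a+w_b$, $w_a+w_b+w_c\le 1$, together with $0\le w_e\le \frac12$ for every edge $e$ that alone forms a connected component. For an integer $t\ge0$, $L^{\mathcal{P}}_G(t)=|t\mathcal{P}_G\cap\mathbb{Z}^E|$; this is a quasi-polynomial in $t$, i.e. there are polynomials $p_0,\dots,p_{\alpha-1}$ with $L^{\mathcal{P}}_G(t)=p_j(t)$ whenever $t\equiv j\pmod\alpha$, and the least such $\alpha$ is its period. *)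

theory Defs
  imports Complex_Main "HOL-Library.Multiset" "HOL-Library.FuncSet"
    "HOL-Computational_Algebra.Polynomial"
begin

section \<open>Finite multigraphs\<close>

text \<open>Edges are abstract objects, so parallel edges are allowed; the two ends of an edge form a
  multiset of size 2, which is \<open>{#v, v#}\<close> for a loop at \<open>v\<close>.\<close>

record ('v, 'e) mgraph =
  nodes :: "'v set"
  edges :: "'e set"
  ends :: "'e \<Rightarrow> 'v multiset"

definition finite_mgraph :: "('v, 'e) mgraph \<Rightarrow> bool" where
  "finite_mgraph G \<longleftrightarrow> finite (nodes G) \<and> finite (edges G) \<and>
     (\<forall>e\<in>edges G. size (ends G e) = 2 \<and> set_mset (ends G e) \<subseteq> nodes G)"

definition degree_mg :: "('v, 'e) mgraph \<Rightarrow> 'v \<Rightarrow> nat" where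
  "degree_mg G v = (\<Sum>e\<in>edges G. count (ends G e) v)"

text \<open>The edges incident with \<open>v\<close>, a loop at \<open>v\<close> being listed twice.\<close>

definition incident_edges :: "('v, 'e) mgraph \<Rightarrow> 'v \<Rightarrow> 'e multiset" where
  "incident_edges G v = (\<Sum>e\<in>edges G. replicate_mset (count (ends G e) v) e)"

definition one_three_graph :: "('v, 'e) mgraph \<Rightarrow> bool" where
  "one_three_graph G \<longleftrightarrow> finite_mgraph G \<and> (\<forall>v\<in>nodes G. degree_mg G v = 1 \<or> degree_mg G v = 3)"

definition internal_nodes :: "('v, 'e) mgraph \<Rightarrow> 'v set" where
  "internal_nodes G = {v \<in> nodes G. degree_mg G v = 3}"

definition cubic_graph :: "('v, 'e) mgraph \<Rightarrow> bool" where
  "cubic_graph G \<longleftrightarrow> finite_mgraph G \<and> (\<forall>v\<in>nodes G. degree_mg G v = 3)"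

definition adjacency :: "('v, 'e) mgraph \<Rightarrow> ('v \<times> 'v) set" where
  "adjacency G = {(u, v). \<exists>e\<in>edges G. ends G e = {#u, v#}}"

definition component_of :: "('v, 'e) mgraph \<Rightarrow> 'v \<Rightarrow> 'v set" where
  "component_of G u = {v \<in> nodes G. (u, v) \<in> (adjacency G)\<^sup>*}"

definition connected_mgraph :: "('v, 'e) mgraph \<Rightarrow> bool" where
  "connected_mgraph G \<longleftrightarrow> nodes G \<noteq> {} \<and> (\<forall>u\<in>nodes G. \<forall>v\<in>nodes G. (u, v) \<in> (adjacency G)\<^sup>*)"

text \<open>A loop is a cycle of length 1, and two parallel edges form a cycle of length 2.\<close>

definition is_cycle :: "('v, 'e) mgraph \<Rightarrow> 'v list \<Rightarrow> 'e list \<Rightarrow> bool" where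
  "is_cycle G vs es \<longleftrightarrow> vs \<noteq> [] \<and> length es = length vs \<and> distinct vs \<and> distinct es \<and>
     set es \<subseteq> edges G \<and>
     (\<forall>i<length vs. ends G (es ! i) = {#vs ! i, vs ! (Suc i mod length vs)#})"

definition tree_mgraph :: "('v, 'e) mgraph \<Rightarrow> bool" where
  "tree_mgraph G \<longleftrightarrow> finite_mgraph G \<and> connected_mgraph G \<and> (\<nexists>vs es. is_cycle G vs es)"

definition is_component_edge :: "('v, 'e) mgraph \<Rightarrow> 'e \<Rightarrow> bool" where
  "is_component_edge G e \<longleftrightarrow>
     (\<exists>u\<in>nodes G. {f \<in> edges G. set_mset (ends G f) \<subseteq> component_of G u} = {e})"


section \<open>The polytope and its lattice point count\<close>

text \<open>\<open>\<real>\<^sup>E\<close> and \<open>\<int>\<^sup>E\<close> are rendered as spaces of extensional functions on the edge set, so that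
  distinct functions are distinct points and cardinalities are meaningful.\<close>

definition polytope_P :: "('v, 'e) mgraph \<Rightarrow> ('e \<Rightarrow> real) set" where
  "polytope_P G = {w \<in> edges G \<rightarrow>\<^sub>E UNIV.
     (\<forall>v\<in>internal_nodes G. \<forall>a b c. incident_edges G v = {#a, b, c#} \<longrightarrow>
        w a \<le> w b + w c \<and> w b \<le> w a + w c \<and> w c \<le> w a + w b \<and> w a + w b + w c \<le> 1) \<and>
     (\<forall>e\<in>edges G. is_component_edge G e \<longrightarrow> 0 \<le> w e \<and> w e \<le> 1 / 2)}"

definition dilate :: "'e set \<Rightarrow> real \<Rightarrow> ('e \<Rightarrow> real) set \<Rightarrow> ('e \<Rightarrow> real) set" where
  "dilate E t P = (\<lambda>w. \<lambda>e\<in>E. t * w e) ` P"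

definition ehrhart_P :: "('v, 'e) mgraph \<Rightarrow> nat \<Rightarrow> nat" where
  "ehrhart_P G t = card (dilate (edges G) (real t) (polytope_P G) \<inter> (edges G \<rightarrow>\<^sub>E \<int>))"


section \<open>Quasi-polynomials\<close>

definition quasi_poly_modulus :: "(nat \<Rightarrow> nat) \<Rightarrow> nat \<Rightarrow> bool" where
  "quasi_poly_modulus f \<alpha> \<longleftrightarrow> \<alpha> > 0 \<and>
     (\<exists>p :: nat \<Rightarrow> real poly. \<forall>j<\<alpha>. \<forall>t. t mod \<alpha> = j \<longrightarrow> real (f t) = poly (p j) (real t))"

definition quasi_polynomial :: "(nat \<Rightarrow> nat) \<Rightarrow> bool" where
  "quasi_polynomial f \<longleftrightarrow> (\<exists>\<alpha>. quasi_poly_modulus f \<alpha>)"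

text \<open>Only meaningful if \<open>f\<close> is a quasi-polynomial.\<close>

definition quasi_period :: "(nat \<Rightarrow> nat) \<Rightarrow> nat" where
  "quasi_period f = (LEAST \<alpha>. quasi_poly_modulus f \<alpha>)"

end

theory Submission
  imports Defs "HOL-Computational_Algebra.Polynomial_FPS"
begin

text \<open>
  Put \<open>N = t + 2\<close>. For labels in \<open>{0..t div 2}\<close> the indicator of a node condition consists of the
  structure constants of a commutative associative algebra whose basis elements act as the Dirichlet
  kernels \<open>x\<^sub>a(\<theta>) = sin ((a + 1/2) \<theta>) / sin (\<theta>/2)\<close> at the points \<open>\<theta> = 2 \<pi> j / N\<close>, \<open>1 \<le> j \<le> N/2\<close>.
  Diagonalising it, the lattice point count of a connected graph with \<open>V > 0\<close> internal nodes,
  \<open>A\<close> edges between internal nodes and \<open>n\<close> leaves becomes the sum over \<open>\<theta>\<close> of \<open>\<omega>\<^bsup>A-V\<^esup> s\<^bsup>n\<^esup>\<close>, where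
  \<open>\<omega>\<close> is the sum of the \<open>x\<^sub>a(\<theta>)\<^sup>2\<close> and \<open>s\<close> that of the \<open>x\<^sub>a(\<theta>)\<close>. Both have closed forms in squared
  cosecants and secants, and power sums of these are polynomials in \<open>N\<close>. The exceptional point
  \<open>\<theta> = \<pi>\<close>, which occurs for even \<open>t\<close> only, has \<open>\<omega> = N/2\<close> and (if there are leaves) contributes only when
  4 divides \<open>t\<close>; it leaves a residue \<open>(N/4)\<^bsup>q\<^esup> (2\<^bsup>q\<^esup> - 1/2)\<close>, \<open>q = A - V\<close>, which vanishes
  exactly for \<open>q = -1\<close>, that is, for trees.
\<close>

section \<open>Power sums of cosecants\<close>

text \<open>The algebra is the integral-spin part of the SU(2) fusion ring at level
  \<open>t\<close>. For even \<open>t\<close> the characters with indices \<open>j\<close> and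
  \<open>N - j\<close> agree on it, and \<open>\<theta> = \<pi>\<close> is the fixed point of this
  reflection. Sums over all indices below \<open>N\<close> have uniform polynomial formulas, so the
  wanted sums arise by halving; halving counts the fixed point with weight 1/2 and its generic value
  \<open>(N/4)^q\<close>, while its true contribution is \<open>(N/2)^q\<close>. This is where both
  terms of the residue come from. The delicate case is that of trees: the exponent -1 puts
  \<open>N\<close> into the denominator, and polynomiality then needs sums divisible by
  \<open>N\<close>. Divisibility comes from the restriction to odd indices, where the sum is a
  difference \<open>P (2 * M) - P M\<close> without constant term. Power sums of
  \<open>1 / (1 - \<zeta>)\<close> over the roots of unity \<open>\<zeta> \<noteq> 1\<close> are the
  starting point because their elementary symmetric functions are, up to sign, binomial coefficients
  divided by \<open>N\<close>; Newton's identities then suffice.\<close>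

definition poly_fun_on :: "nat set \<Rightarrow> (nat \<Rightarrow> 'a :: comm_ring_1) \<Rightarrow> bool" where
  "poly_fun_on A f \<longleftrightarrow> (\<exists>p. \<forall>n\<in>A. f n = poly p (of_nat n))"

lemma poly_fun_on_cong:
  "(\<And>n. n \<in> A \<Longrightarrow> f n = g n) \<Longrightarrow> poly_fun_on A f \<longleftrightarrow> poly_fun_on A g"
  by (simp add: poly_fun_on_def)

lemma poly_fun_on_subset: "poly_fun_on A f \<Longrightarrow> B \<subseteq> A \<Longrightarrow> poly_fun_on B f"
  by (auto simp: poly_fun_on_def)

lemma poly_fun_on_const: "poly_fun_on A (\<lambda>_. c)"
  unfolding poly_fun_on_def by (rule exI[of _ "[:c:]"]) simp

lemma poly_fun_on_of_nat: "poly_fun_on A of_nat"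
  unfolding poly_fun_on_def by (rule exI[of _ "[:0, 1:]"]) simp

lemma poly_fun_on_add:
  "poly_fun_on A f \<Longrightarrow> poly_fun_on A g \<Longrightarrow> poly_fun_on A (\<lambda>n. f n + g n)"
  unfolding poly_fun_on_def by (metis poly_add)

lemma poly_fun_on_diff:
  "poly_fun_on A f \<Longrightarrow> poly_fun_on A g \<Longrightarrow> poly_fun_on A (\<lambda>n. f n - g n)"
  unfolding poly_fun_on_def by (metis poly_diff)

lemma poly_fun_on_mult:
  "poly_fun_on A f \<Longrightarrow> poly_fun_on A g \<Longrightarrow> poly_fun_on A (\<lambda>n. f n * g n)"
  unfolding poly_fun_on_def by (metis poly_mult)

lemma poly_fun_on_power: "poly_fun_on A f \<Longrightarrow> poly_fun_on A (\<lambda>n. f n ^ k)"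
  unfolding poly_fun_on_def by (metis poly_power)

lemma poly_fun_on_sum:
  "(\<And>i. i \<in> I \<Longrightarrow> poly_fun_on A (f i)) \<Longrightarrow> poly_fun_on A (\<lambda>n. \<Sum>i\<in>I. f i n)"
  by (induction I rule: infinite_finite_induct) (auto intro: poly_fun_on_const poly_fun_on_add)

lemma poly_fun_on_prod:
  "(\<And>i. i \<in> I \<Longrightarrow> poly_fun_on A (f i)) \<Longrightarrow> poly_fun_on A (\<lambda>n. \<Prod>i\<in>I. f i n)"
  by (induction I rule: infinite_finite_induct) (auto intro: poly_fun_on_const poly_fun_on_mult)

lemmas poly_fun_on_intros = poly_fun_on_const poly_fun_on_of_nat poly_fun_on_add poly_fun_on_diff
  poly_fun_on_mult poly_fun_on_power poly_fun_on_sum poly_fun_on_prod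

lemma poly_fun_on_affine:
  fixes f :: "nat \<Rightarrow> 'a :: comm_ring_1"
  assumes "poly_fun_on B f" and "\<And>n. n \<in> A \<Longrightarrow> g n \<in> B"
    and "\<And>n. n \<in> A \<Longrightarrow> (of_nat (g n) :: 'a) = c * of_nat n + d"
  shows "poly_fun_on A (\<lambda>n. f (g n))"
proof -
  obtain p where p: "\<And>n. n \<in> B \<Longrightarrow> f n = poly p (of_nat n)"
    using assms(1) by (auto simp: poly_fun_on_def)
  have "f (g n) = poly (p \<circ>\<^sub>p [:d, c:]) (of_nat n)" if "n \<in> A" for n
    using assms(2,3)[OF that] p by (simp add: poly_pcompose algebra_simps)
  thus ?thesis by (auto simp: poly_fun_on_def)
qed

text \<open>Polynomiality is first obtained over the complex numbers. At natural arguments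
  evaluation commutes with taking real parts of the coefficients, which brings it back to the
  reals.\<close>

lemma poly_fun_on_of_real:
  fixes f :: "nat \<Rightarrow> real"
  assumes "poly_fun_on A (\<lambda>n. complex_of_real (f n))"
  shows "poly_fun_on A f"
proof -
  obtain p where p: "\<And>n. n \<in> A \<Longrightarrow> complex_of_real (f n) = poly p (of_nat n)"
    using assms by (auto simp: poly_fun_on_def)
  have *: "Re (poly q (of_nat n)) = poly (map_poly Re q) (of_nat n)" for q and n :: nat
    by (induction q) (auto simp: map_poly_pCons)
  have "f n = poly (map_poly Re p) (of_nat n)" if "n \<in> A" for n
    using p[OF that] * by (metis Re_complex_of_real)
  thus ?thesis by (auto simp: poly_fun_on_def)
qed

text \<open>Newton's identities, read off as coefficient \<open>k\<close> of the logarithmic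
  derivative: \<open>P'\<close> is \<open>- P\<close> times the sum of the
  \<open>u j / (1 - u j * X)\<close>. The coefficients of \<open>P\<close> are, up to sign, the
  elementary symmetric functions of the \<open>u j\<close>.\<close>

lemma newton_power_sums:
  fixes u :: "'i \<Rightarrow> 'a :: field"
  assumes "finite J"
  defines "P \<equiv> \<Prod>j\<in>J. [:1, - u j:]"
  shows "(\<Sum>i\<le>k. coeff P i * (\<Sum>j\<in>J. u j ^ (Suc k - i))) = - of_nat (Suc k) * coeff P (Suc k)"
proof -
  define geo :: "'a \<Rightarrow> 'a fps" where "geo = (\<lambda>c. Abs_fps (\<lambda>n. c ^ n))"
  have geo: "(1 - fps_const c * fps_X) * geo c = 1" for c
  proof (rule fps_ext)
    fix n show "fps_nth ((1 - fps_const c * fps_X) * geo c) n = fps_nth 1 n"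
      by (cases n) (simp_all add: geo_def ring_distribs mult.assoc)
  qed
  have "fps_deriv (\<Prod>j\<in>J. 1 - fps_const (u j) * fps_X) =
          - (\<Prod>j\<in>J. 1 - fps_const (u j) * fps_X) * (\<Sum>j\<in>J. fps_const (u j) * geo (u j))"
    using assms(1)
  proof (induction J rule: finite_induct)
    case (insert j J)
    let ?P = "\<Prod>j\<in>J. 1 - fps_const (u j) * fps_X"
    let ?G = "\<Sum>j\<in>J. fps_const (u j) * geo (u j)"
    let ?l = "1 - fps_const (u j) * fps_X"
    \<comment> \<open>Inserting \<open>1 = ?l * geo (u j)\<close> makes the derivative a multiple of
      the factor, so no division of power series occurs.\<close>
    have l: "fps_deriv ?l = - (fps_const (u j) * (?l * geo (u j)))" by (simp only: geo) simp
    have "fps_deriv (?l * ?P) = fps_deriv ?l * ?P + ?l * fps_deriv ?P"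
      by (simp only: fps_deriv_mult add.commute)
    also have "\<dots> = - (fps_const (u j) * (?l * geo (u j))) * ?P + ?l * (- ?P * ?G)"
      by (simp only: l insert.IH)
    also have "\<dots> = - (?l * ?P) * (fps_const (u j) * geo (u j) + ?G)"
      by (simp add: algebra_simps)
    finally show ?case using insert.hyps by simp
  qed simp
  moreover have "(\<Prod>j\<in>J. 1 - fps_const (u j) * fps_X) = fps_of_poly P"
    unfolding P_def fps_of_poly_prod by (intro prod.cong refl) (simp add: fps_of_poly_linear')
  ultimately have "fps_deriv (fps_of_poly P) =
      - (fps_of_poly P * (\<Sum>j\<in>J. fps_const (u j) * geo (u j)))" by simp
  hence "fps_nth (fps_deriv (fps_of_poly P)) k =
      fps_nth (- (fps_of_poly P * (\<Sum>j\<in>J. fps_const (u j) * geo (u j)))) k" by simp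
  hence "of_nat (Suc k) * coeff P (Suc k) =
      - (\<Sum>i\<le>k. coeff P i * (\<Sum>j\<in>J. u j * u j ^ (k - i)))"
    by (simp add: fps_mult_nth[of "fps_of_poly P"] fps_sum_nth fps_mult_left_const_nth geo_def
        atMost_atLeast0)
  moreover have "(\<Sum>i\<le>k. coeff P i * (\<Sum>j\<in>J. u j * u j ^ (k - i))) =
      (\<Sum>i\<le>k. coeff P i * (\<Sum>j\<in>J. u j ^ (Suc k - i)))"
    by (intro sum.cong refl) (simp add: Suc_diff_le)
  ultimately show ?thesis by (simp only: mult_minus_left minus_minus)
qed

lemma sin_pi_mult_div_neq_0:
  assumes "0 < j" "j < N"
  shows "sin (pi * real j / real N) \<noteq> 0"
proof -
  have "sin (pi * real j / real N) > 0"
    using assms by (intro sin_gt_zero) (auto simp: field_simps)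
  thus ?thesis by simp
qed

text \<open>\<open>(1 - (1 - x) ^ N) / (N * x)\<close> has constant term 1 and vanishes at the
  points \<open>1 - \<zeta>\<close> for the \<open>N\<close>-th roots of unity
  \<open>\<zeta> \<noteq> 1\<close>, so it is the product of the \<open>1 - z j * x\<close>. The
  binomial theorem gives its coefficients.\<close>

lemma coeff_prod_roots_unity:
  fixes N :: nat
  assumes "N > 0"
  defines "z \<equiv> \<lambda>j::nat. 1 / (1 - cis (2 * pi * real j / real N))"
  shows "coeff (\<Prod>j\<in>{1..<N}. [:1, - z j:]) k = (-1) ^ k * of_nat (N choose Suc k) / of_nat N"
proof -
  let ?\<zeta> = "\<lambda>j::nat. cis (2 * pi * real j / real N)"
  let ?P = "\<Prod>j\<in>{1..<N}. [:1, - z j:]"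
  define c :: "nat \<Rightarrow> complex" where "c = (\<lambda>k. (-1) ^ k * of_nat (N choose Suc k) / of_nat N)"
  define R where "R = (\<Sum>k<N. monom (c k) k)"
  note bij = bij_betw_roots_unity[OF assms(1)]
  have neq: "1 - ?\<zeta> j \<noteq> 0" if "j \<in> {1..<N}" for j
  proof
    assume "1 - ?\<zeta> j = 0"
    hence "?\<zeta> j = ?\<zeta> 0" by simp
    hence "j = 0"
      using bij that assms(1) unfolding bij_betw_def by (intro inj_onD[of ?\<zeta> "{..<N}" j 0]) auto
    with that show False by simp
  qed
  have R: "of_nat N * x * poly R x = 1 - (1 - x) ^ N" for x
  proof -
    have "(1 - x) ^ N = (\<Sum>k\<le>N. of_nat (N choose k) * (- x) ^ k)"
      using binomial_ring[of "- x" 1 N] by simp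
    also have "{..N} = insert 0 (Suc ` {..<N})" by (auto simp: lessThan_Suc_atMost[symmetric] lessThan_Suc_eq_insert_0)
    also have "(\<Sum>k\<in>\<dots>. of_nat (N choose k) * (- x) ^ k) =
        1 + (\<Sum>k<N. of_nat (N choose Suc k) * (- x) ^ Suc k)"
      by (subst sum.insert) (auto simp: sum.reindex simp del: power_Suc)
    also have "(\<Sum>k<N. of_nat (N choose Suc k) * (- x) ^ Suc k) = - (of_nat N * x * poly R x)"
      using assms(1)
      by (auto simp: R_def c_def poly_sum poly_monom sum_distrib_left power_minus[of x] mult_ac
          simp flip: sum_negf intro!: sum.cong)
    finally show ?thesis by simp
  qed
  \<comment> \<open>Both sides have degree below \<open>N\<close> and agree at the \<open>N\<close>
    points \<open>1 - ?\<zeta> j\<close>; the index 0 gives the point 0, where both are 1.\<close>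
  have "?P = R"
  proof (rule poly_eqI_degree)
    have inj: "inj_on (\<lambda>j. 1 - ?\<zeta> j) {..<N}"
      using bij by (auto simp: bij_betw_def inj_on_def)
    have card: "card ((\<lambda>j. 1 - ?\<zeta> j) ` {..<N}) = N" using card_image[OF inj] by simp
    show "card ((\<lambda>j. 1 - ?\<zeta> j) ` {..<N}) > degree R"
      unfolding card R_def using assms(1)
      by (intro degree_sum_less) (auto intro: le_less_trans[OF degree_monom_le])
    have "degree ?P \<le> (\<Sum>j\<in>{1..<N}. degree [:1, - z j:])"
      using degree_prod_sum_le[of "{1..<N}" "\<lambda>j. [:1, - z j:]"] by (simp add: o_def)
    also have "\<dots> \<le> (\<Sum>j\<in>{1..<N}. 1)"
      by (rule sum_mono) simp
    also have "\<dots> < N" using assms(1) by simp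
    finally show "card ((\<lambda>j. 1 - ?\<zeta> j) ` {..<N}) > degree ?P" using card by simp
    fix x assume "x \<in> (\<lambda>j. 1 - ?\<zeta> j) ` {..<N}"
    then obtain j where j: "j < N" "x = 1 - ?\<zeta> j" by auto
    show "poly ?P x = poly R x"
    proof (cases "j = 0")
      case True
      hence "x = 0" using j by simp
      moreover have "poly R 0 = 1"
        using assms(1) by (simp add: R_def poly_sum poly_monom c_def power_0_left if_distrib
            sum.delta cong: if_cong)
      ultimately show ?thesis by (simp add: poly_prod)
    next
      case False
      hence jN: "j \<in> {1..<N}" using j by auto
      have "(1 - x) ^ N = 1" using bij j by (auto simp: bij_betw_def)
      hence "poly R x = 0" using R[of x] neq[OF jN] j assms(1) by simp
      moreover have "poly [:1, - z j:] x = 0" using neq[OF jN] j by (simp add: z_def)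
      hence "poly ?P x = 0" unfolding poly_prod using jN by (intro prod_zero) auto
      ultimately show ?thesis by simp
    qed
  qed
  moreover have "coeff R k = c k"
    by (cases "k < N") (auto simp: R_def coeff_sum sum.delta c_def cong: if_cong)
  ultimately show ?thesis by (simp add: c_def)
qed

text \<open>\<open>N choose Suc k\<close> is \<open>N / Suc k\<close> times
  \<open>(N - 1) choose k\<close>, so the factor \<open>N\<close> cancels.\<close>

lemma poly_fun_on_binomial_div:
  "poly_fun_on {0<..} (\<lambda>N. of_nat (N choose Suc k) / of_nat N :: 'a :: field_char_0)"
proof -
  have "of_nat (N choose Suc k) / of_nat N =
      (\<Prod>i<k. of_nat N - 1 - of_nat i :: 'a) * (1 / (of_nat (Suc k) * fact k))" if "N > 0" for N
  proof -
    obtain M where M: "N = Suc M" using \<open>N > 0\<close> by (cases N) auto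
    have "of_nat (Suc k) * of_nat (N choose Suc k) = (of_nat N * of_nat (M choose k) :: 'a)"
      unfolding M by (metis Suc_times_binomial_eq of_nat_mult mult.commute)
    moreover have "of_nat (M choose k) = (\<Prod>i<k. of_nat N - 1 - of_nat i :: 'a) / fact k"
      by (simp add: binomial_gbinomial gbinomial_prod_rev M atLeast0LessThan)
    ultimately show ?thesis using \<open>N > 0\<close>
      by (simp add: field_simps del: of_nat_Suc)
  qed
  moreover have "poly_fun_on {0<..}
      (\<lambda>N. (\<Prod>i<k. of_nat N - 1 - of_nat i :: 'a) * (1 / (of_nat (Suc k) * fact k)))"
    by (intro poly_fun_on_intros)
  ultimately show ?thesis by (subst poly_fun_on_cong) auto
qed

text \<open>The symmetric functions of the \<open>1 / (1 - \<zeta>)\<close> are polynomials in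
  \<open>N\<close> and the zeroth one is 1, so Newton's recursion can be solved for the highest
  power sum and passes polynomiality on from the lower ones.\<close>

lemma poly_fun_on_power_sum_roots_unity:
  "poly_fun_on {0<..} (\<lambda>N. \<Sum>j\<in>{1..<N}. (1 / (1 - cis (2 * pi * real j / real N))) ^ k)"
proof (induction k rule: less_induct)
  case (less k)
  define p where "p = (\<lambda>k N. \<Sum>j\<in>{1..<N}. (1 / (1 - cis (2 * pi * real j / real N))) ^ k)"
  define e :: "nat \<Rightarrow> nat \<Rightarrow> complex" where "e = (\<lambda>k N. (-1) ^ k * (of_nat (N choose Suc k) / of_nat N))"
  have e: "poly_fun_on {0<..} (e k)" for k
    unfolding e_def by (intro poly_fun_on_intros poly_fun_on_binomial_div)
  show ?case
  proof (cases k)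
    case 0
    have "poly_fun_on {0<..} (\<lambda>N. of_nat N - 1 :: complex)" by (intro poly_fun_on_intros)
    thus ?thesis unfolding 0 by (subst poly_fun_on_cong) (auto simp: of_nat_diff Suc_leI)
  next
    case (Suc k')
    have "p k N = - of_nat k * e k N - (\<Sum>i\<in>{1..k'}. e i N * p (k - i) N)" if "N > 0" for N
    proof -
      have "(\<Sum>i\<le>k'. e i N * p (Suc k' - i) N) = - of_nat (Suc k') * e (Suc k') N"
        using newton_power_sums[of "{1..<N}" "\<lambda>j. 1 / (1 - cis (2 * pi * real j / real N))" k']
        unfolding coeff_prod_roots_unity[OF that] p_def e_def by (simp only: times_divide_eq_right finite_atLeastLessThan simp_thms)
      moreover have "{..k'} = insert 0 {1..k'}" by auto
      moreover have "e 0 N = 1" using that by (simp add: e_def)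
      ultimately show ?thesis using Suc by (simp add: algebra_simps)
    qed
    moreover have "poly_fun_on {0<..} (\<lambda>N. - of_nat k * e k N - (\<Sum>i\<in>{1..k'}. e i N * p (k - i) N))"
    proof (intro poly_fun_on_intros e)
      fix i assume "i \<in> {1..k'}"
      thus "poly_fun_on {0<..} (p (k - i))" using less[of "k - i"] Suc unfolding p_def by simp
    qed
    ultimately show ?thesis unfolding p_def by (subst poly_fun_on_cong) auto
  qed
qed

definition csc_sum :: "nat \<Rightarrow> nat \<Rightarrow> real" where
  "csc_sum p N = (\<Sum>j\<in>{1..<N}. (1 / sin (pi * real j / real N) ^ 2) ^ p)"

text \<open>\<open>z = 1 / (1 - \<zeta>)\<close> has real part \<open>1/2\<close>, so \<open>|z|\<^sup>2 = z (1 - z)\<close>; hence sums of powers of squared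
  cosecants are linear combinations of power sums of the \<open>z\<close>.\<close>

lemma csc_squared_eq:
  assumes "sin \<alpha> \<noteq> 0"
  defines "z \<equiv> 1 / (1 - cis (2 * \<alpha>))"
  shows "complex_of_real (1 / sin \<alpha> ^ 2) = 4 * (z - z ^ 2)"
proof -
  have cis2: "cis (2 * \<alpha>) = cis \<alpha> ^ 2" by (simp add: DeMoivre)
  have "1 - cis (2 * \<alpha>) = - (2 * \<i> * sin \<alpha> * cis \<alpha>)"
    by (simp add: complex_eq_iff cos_double sin_double power2_eq_square cos_squared_eq)
       (simp add: sin_squared_eq flip: power2_eq_square)
  hence sq: "(1 - cis (2 * \<alpha>)) ^ 2 = - 4 * of_real (sin \<alpha>) ^ 2 * cis (2 * \<alpha>)"
    and ne: "1 - cis (2 * \<alpha>) \<noteq> 0"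
    using assms(1) by (simp_all add: cis2 power_mult_distrib)
  have "z - z ^ 2 = (1 - cis (2 * \<alpha>) - 1) / (1 - cis (2 * \<alpha>)) ^ 2"
    using ne unfolding z_def by (simp add: power2_eq_square divide_simps)
  also have "\<dots> = - cis (2 * \<alpha>) / (- 4 * of_real (sin \<alpha>) ^ 2 * cis (2 * \<alpha>))"
    by (simp only: sq) simp
  finally show ?thesis using assms(1) by (simp add: field_simps)
qed

lemma poly_fun_on_csc_sum: "poly_fun_on {0<..} (csc_sum p)"
proof (rule poly_fun_on_of_real)
  define z where "z = (\<lambda>N j. 1 / (1 - cis (2 * pi * real j / real N)))"
  have "complex_of_real (csc_sum p N) =
      (\<Sum>i\<le>p. 4 ^ p * of_nat (p choose i) * (-1) ^ i * (\<Sum>j\<in>{1..<N}. z N j ^ (p + i)))" for N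
  proof -
    have "complex_of_real (1 / sin (pi * real j / real N) ^ 2) = 4 * (z N j - z N j ^ 2)"
      if "j \<in> {1..<N}" for j
      using csc_squared_eq[OF sin_pi_mult_div_neq_0[of j N]] that
      unfolding z_def by (simp add: mult.assoc)
    hence "complex_of_real (csc_sum p N) = (\<Sum>j\<in>{1..<N}. (4 * (z N j - z N j ^ 2)) ^ p)"
      unfolding csc_sum_def of_real_sum of_real_power by (intro sum.cong) auto
    also have "\<dots> = (\<Sum>j\<in>{1..<N}. \<Sum>i\<le>p. 4 ^ p * of_nat (p choose i) * (-1) ^ i * z N j ^ (p + i))"
    proof (intro sum.cong refl)
      fix j
      have "4 * (z N j - z N j ^ 2) = 4 * z N j * (- z N j + 1)"
        by (simp add: power2_eq_square algebra_simps)
      hence "(4 * (z N j - z N j ^ 2)) ^ p = 4 ^ p * z N j ^ p * (- z N j + 1) ^ p"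
        by (simp only: power_mult_distrib)
      also have "(- z N j + 1) ^ p = (\<Sum>i\<le>p. of_nat (p choose i) * (- z N j) ^ i)"
        using binomial_ring[of "- z N j" 1 p] by simp
      finally show "(4 * (z N j - z N j ^ 2)) ^ p =
          (\<Sum>i\<le>p. 4 ^ p * of_nat (p choose i) * (-1) ^ i * z N j ^ (p + i))"
        by (simp add: sum_distrib_left power_add power_minus[of "z N j"] mult_ac)
    qed
    also have "\<dots> = (\<Sum>i\<le>p. 4 ^ p * of_nat (p choose i) * (-1) ^ i * (\<Sum>j\<in>{1..<N}. z N j ^ (p + i)))"
      by (subst sum.swap) (simp add: sum_distrib_left)
    finally show ?thesis .
  qed
  moreover have "poly_fun_on {0<..}
      (\<lambda>N. \<Sum>i\<le>p. 4 ^ p * of_nat (p choose i) * (-1) ^ i * (\<Sum>j\<in>{1..<N}. z N j ^ (p + i)))"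
    unfolding z_def by (intro poly_fun_on_intros poly_fun_on_power_sum_roots_unity)
  ultimately show "poly_fun_on {0<..} (\<lambda>N. complex_of_real (csc_sum p N))" by simp
qed

section \<open>The fusion algebra\<close>

text \<open>The fusion rule for integral spins in SU(2) at level \<open>t\<close>; in terms of
  doubled spins the usual parity condition holds automatically.\<close>

definition admissible :: "nat \<Rightarrow> nat \<Rightarrow> nat \<Rightarrow> nat \<Rightarrow> bool" where
  "admissible t a b c \<longleftrightarrow> a \<le> b + c \<and> b \<le> a + c \<and> c \<le> a + b \<and> a + b + c \<le> t"

text \<open>Half of the angle \<open>\<theta>\<close> with \<open>(t + 2) \<theta> \<in> 2 \<pi> \<int>\<close>. Doubling it for odd \<open>t\<close> only permutes the angles,
  but makes the closed form of \<open>leaf_sum\<close> independent of the parity of \<open>j\<close>.\<close>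

definition half_angle :: "nat \<Rightarrow> nat \<Rightarrow> real" where
  "half_angle t j = (if even t then pi * real j / real (t + 2) else 2 * pi * real j / real (t + 2))"

definition character :: "nat \<Rightarrow> nat \<Rightarrow> nat \<Rightarrow> real" where
  "character t j a = sin (real (2 * a + 1) * half_angle t j) / sin (half_angle t j)"

definition character_norm :: "nat \<Rightarrow> nat \<Rightarrow> real" where
  "character_norm t j = (\<Sum>a\<le>t div 2. character t j a ^ 2)"

definition leaf_sum :: "nat \<Rightarrow> nat \<Rightarrow> real" where
  "leaf_sum t j = (\<Sum>a\<le>t div 2. character t j a)"

section \<open>Trigonometric sums and orthogonality of the characters\<close>

lemma sin_pi_int_div_eq_0_iff:
  assumes "N > 0"
  shows "sin (pi * real_of_int k / real N) = 0 \<longleftrightarrow> int N dvd k"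
proof -
  have "sin (pi * real_of_int k / real N) = 0 \<longleftrightarrow> (\<exists>i::int. pi * real_of_int k / real N = of_int i * pi)"
    by (rule sin_zero_iff_int2)
  also have "\<dots> \<longleftrightarrow> (\<exists>i::int. real_of_int k = real_of_int (int N * i))"
    using assms by (intro ex_cong1) (auto simp: field_simps)
  also have "\<dots> \<longleftrightarrow> int N dvd k"
    unfolding of_int_eq_iff by (auto simp: dvd_def)
  finally show ?thesis .
qed

lemma sin_half_angle_neq_0:
  assumes "j \<in> {1..(t + 2) div 2}"
  shows "sin (half_angle t j) \<noteq> 0"
proof -
  have "sin (half_angle t j) > 0"
  proof (rule sin_gt_zero)
    show "0 < half_angle t j" using assms by (auto simp: half_angle_def)
    show "half_angle t j < pi"
    proof (cases "even t")
      case True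
      have "real j < real (t + 2)" using assms by auto
      hence "pi * real j < pi * real (t + 2)" by (intro mult_strict_left_mono) auto
      thus ?thesis using True by (simp add: half_angle_def field_simps)
    next
      case False
      have "2 * j < t + 2" using assms False by auto presburger
      hence "real (2 * j) < real (t + 2)" by linarith
      hence "pi * real (2 * j) < pi * real (t + 2)" by (intro mult_strict_left_mono) auto
      thus ?thesis using False by (simp add: half_angle_def field_simps)
    qed
  qed
  thus ?thesis by simp
qed

text \<open>Here and in the next two lemmas the product formulas turn the summand into a difference
  of neighbouring terms, and the sum telescopes.\<close>

lemma sum_sin_odd_multiples:
  "(\<Sum>c\<in>{lo..<lo + n}. 2 * sin \<alpha> * sin (real (2 * c + 1) * \<alpha>)) =
     cos (real (2 * lo) * \<alpha>) - cos (real (2 * (lo + n)) * \<alpha>)"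
proof (induction n)
  case (Suc n)
  have "2 * sin \<alpha> * sin (real (2 * (lo + n) + 1) * \<alpha>) =
      cos (real (2 * (lo + n) + 1) * \<alpha> - \<alpha>) - cos (real (2 * (lo + n) + 1) * \<alpha> + \<alpha>)"
    by (simp only: cos_diff cos_add) (simp add: mult_ac)
  also have "real (2 * (lo + n) + 1) * \<alpha> - \<alpha> = real (2 * (lo + n)) * \<alpha>"
    by (simp add: algebra_simps)
  also have "real (2 * (lo + n) + 1) * \<alpha> + \<alpha> = real (2 * (lo + Suc n)) * \<alpha>"
    by (simp add: algebra_simps)
  finally show ?case using Suc by simp
qed simp

lemma sum_cos_odd_multiples:
  "(\<Sum>a<n. 2 * sin \<gamma> * cos (real (2 * a + 1) * \<gamma>)) = sin (real (2 * n) * \<gamma>)"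
proof (induction n)
  case (Suc n)
  have "2 * sin \<gamma> * cos (real (2 * n + 1) * \<gamma>) =
      sin (real (2 * n + 1) * \<gamma> + \<gamma>) - sin (real (2 * n + 1) * \<gamma> - \<gamma>)"
    by (simp only: sin_diff sin_add) (simp add: mult_ac)
  also have "real (2 * n + 1) * \<gamma> - \<gamma> = real (2 * n) * \<gamma>"
    by (simp add: algebra_simps)
  also have "real (2 * n + 1) * \<gamma> + \<gamma> = real (2 * Suc n) * \<gamma>"
    by (simp add: algebra_simps)
  finally show ?case using Suc by simp
qed simp

lemma sum_cos_even_multiples:
  "(\<Sum>j\<in>{1..n}. 2 * sin \<beta> * cos (real (2 * j) * \<beta>)) = sin (real (2 * n + 1) * \<beta>) - sin \<beta>"
proof (induction n)
  case (Suc n)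
  have "2 * sin \<beta> * cos (real (2 * Suc n) * \<beta>) =
      sin (real (2 * Suc n) * \<beta> + \<beta>) - sin (real (2 * Suc n) * \<beta> - \<beta>)"
    by (simp only: sin_diff sin_add) (simp add: mult_ac)
  also have "real (2 * Suc n) * \<beta> - \<beta> = real (2 * n + 1) * \<beta>"
    by (simp add: algebra_simps)
  also have "real (2 * Suc n) * \<beta> + \<beta> = real (2 * Suc n + 1) * \<beta>"
    by (simp add: algebra_simps)
  finally show ?case using Suc by simp
qed simp

text \<open>\<open>(t + 2) * half_angle t j\<close> is an integer multiple of \<open>\<pi>\<close>,
  so replacing \<open>m\<close> by \<open>t + 2 - m\<close> negates the argument up to full periods.
  This makes the level cutoff of the fusion rule invisible to the characters.\<close>

lemma cos_half_angle_reflect: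
  assumes "m \<le> t + 2"
  shows "cos (real (2 * (t + 2 - m)) * half_angle t j) = cos (real (2 * m) * half_angle t j)"
proof -
  define K where "K = (if even t then int j else 2 * int j)"
  have "real (t + 2) * half_angle t j = pi * of_int K"
    by (auto simp: half_angle_def K_def)
  hence "real (2 * (t + 2 - m)) * half_angle t j = 2 * pi * of_int K - real (2 * m) * half_angle t j"
    using assms by (simp add: of_nat_diff algebra_simps)
  moreover have "cos (2 * pi * of_int K) = 1" "sin (2 * pi * of_int K) = 0"
    by (simp_all add: cos_int_2pin sin_int_2pin)
  ultimately show ?thesis by (simp only: cos_diff mult_1_left mult_zero_left add_0_right)
qed

text \<open>The admissible \<open>c\<close> form an interval starting at
  \<open>\<bar>a - b\<bar>\<close>; the sum of sines over it telescopes to the product-to-sum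
  formula for the left side.\<close>

lemma character_mult:
  assumes j: "j \<in> {1..(t + 2) div 2}" and a: "a \<le> t div 2" and b: "b \<le> t div 2"
  shows "character t j a * character t j b = (\<Sum>c\<le>t div 2. of_bool (admissible t a b c) * character t j c)"
proof -
  define \<alpha> where "\<alpha> = half_angle t j"
  have s: "sin \<alpha> \<noteq> 0" using sin_half_angle_neq_0[OF j] by (simp add: \<alpha>_def)
  define lo where "lo = (if a \<le> b then b - a else a - b)"
  \<comment> \<open>\<open>hi\<close> is the exclusive upper end. For \<open>2 * (a + b) > t\<close>
    the bound \<open>c \<le> t - a - b\<close> takes over, and its end is the mirror image of
    \<open>a + b + 1\<close> in \<open>t + 2\<close>.\<close>
  define hi where "hi = (if 2 * (a + b) \<le> t then a + b + 1 else t + 2 - (a + b + 1))"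
  have lohi: "lo \<le> hi" using a b by (auto simp: lo_def hi_def)
  have set: "{c. c \<le> t div 2 \<and> admissible t a b c} = {lo..<lo + (hi - lo)}"
    using a b by (auto simp: lo_def hi_def admissible_def split: if_splits)
  have hi_cos: "cos (real (2 * hi) * \<alpha>) = cos (real (2 * (a + b + 1)) * \<alpha>)"
    using a b cos_half_angle_reflect[of "a + b + 1" t j] by (auto simp: hi_def \<alpha>_def)
  have lo_cos: "cos (real (2 * lo) * \<alpha>) = cos ((real (2 * a + 1) * \<alpha>) - (real (2 * b + 1) * \<alpha>))"
  proof (cases "a \<le> b")
    case True
    hence "real (2 * lo) * \<alpha> = - ((real (2 * a + 1) * \<alpha>) - (real (2 * b + 1) * \<alpha>))"
      by (simp add: lo_def of_nat_diff algebra_simps)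
    thus ?thesis by (simp only: cos_minus)
  next
    case False
    hence "real (2 * lo) * \<alpha> = (real (2 * a + 1) * \<alpha>) - (real (2 * b + 1) * \<alpha>)"
      by (simp add: lo_def of_nat_diff algebra_simps)
    thus ?thesis by (simp only:)
  qed
  have sum_eq: "real (2 * (a + b + 1)) * \<alpha> = (real (2 * a + 1) * \<alpha>) + (real (2 * b + 1) * \<alpha>)"
    by (simp add: algebra_simps)
  have "(\<Sum>c\<in>{lo..<lo + (hi - lo)}. 2 * sin \<alpha> * sin (real (2 * c + 1) * \<alpha>)) =
      cos (real (2 * lo) * \<alpha>) - cos (real (2 * hi) * \<alpha>)"
    using lohi by (subst sum_sin_odd_multiples) simp
  also have "\<dots> = 2 * (sin (real (2 * a + 1) * \<alpha>) * sin (real (2 * b + 1) * \<alpha>))"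
    unfolding hi_cos lo_cos sum_eq cos_diff cos_add by simp
  finally have main: "sin \<alpha> * (\<Sum>c\<in>{lo..<lo + (hi - lo)}. sin (real (2 * c + 1) * \<alpha>)) =
      sin (real (2 * a + 1) * \<alpha>) * sin (real (2 * b + 1) * \<alpha>)"
    by (simp add: sum_distrib_left mult.assoc flip: sum_distrib_left)
  have "(\<Sum>c\<le>t div 2. of_bool (admissible t a b c) * character t j c) = (\<Sum>c | c \<le> t div 2 \<and> admissible t a b c. character t j c)"
    by (rule sum.mono_neutral_cong_right) auto
  also have "\<dots> = (\<Sum>c\<in>{lo..<lo + (hi - lo)}. sin (real (2 * c + 1) * \<alpha>)) / sin \<alpha>"
    unfolding set character_def \<alpha>_def sum_divide_distrib ..
  also have "\<dots> = character t j a * character t j b"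
    using main s unfolding character_def \<alpha>_def[symmetric] by (simp add: field_simps)
  finally show ?thesis ..
qed

lemma sum_cos_odd_multiples_even:
  assumes "even t" "\<not> int (t + 2) dvd d"
  shows "(\<Sum>a\<le>t div 2. cos (real (2 * a + 1) * (pi * of_int d / real (t + 2)))) = 0"
proof -
  define \<gamma> where "\<gamma> = pi * of_int d / real (t + 2)"
  have s: "sin \<gamma> \<noteq> 0" unfolding \<gamma>_def using assms by (subst sin_pi_int_div_eq_0_iff) auto
  have "real (2 * (t div 2 + 1)) = real (t + 2)" using assms by auto
  hence "real (2 * (t div 2 + 1)) * \<gamma> = pi * of_int d"
    by (simp only: \<gamma>_def) simp
  hence "(\<Sum>a<t div 2 + 1. 2 * sin \<gamma> * cos (real (2 * a + 1) * \<gamma>)) = sin (pi * of_int d)"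
    by (subst sum_cos_odd_multiples) simp
  also have "\<dots> = 0" using sin_zero_iff_int2[of "pi * of_int d"] by (simp add: mult.commute)
  finally show ?thesis using s
    unfolding \<gamma>_def[symmetric] by (simp add: lessThan_Suc_atMost flip: sum_distrib_left)
qed

text \<open>For odd \<open>t\<close> twice the number of labels is \<open>t + 1\<close> instead of
  \<open>t + 2\<close>, which leaves -1/2 in place of 0. The value is the same for all
  \<open>d\<close>, and orthogonality takes only differences of such sums.\<close>

lemma sum_cos_odd_multiples_odd:
  assumes "odd t" "\<not> int (t + 2) dvd d"
  shows "(\<Sum>a\<le>t div 2. cos (real (2 * a + 1) * (2 * pi * of_int d / real (t + 2)))) = - 1 / 2"
proof -
  define \<gamma> where "\<gamma> = pi * of_int (2 * d) / real (t + 2)"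
  have "coprime (int (t + 2)) 2" using assms by (simp add: coprime_commute)
  hence "\<not> int (t + 2) dvd 2 * d" using assms by (simp add: coprime_dvd_mult_right_iff)
  hence s: "sin \<gamma> \<noteq> 0" unfolding \<gamma>_def by (subst sin_pi_int_div_eq_0_iff) auto
  have "real (2 * (t div 2 + 1)) = real (t + 2) - 1" using assms by (auto elim!: oddE)
  hence "real (2 * (t div 2 + 1)) * \<gamma> = 2 * pi * of_int d - \<gamma>"
    by (simp only: \<gamma>_def) (simp add: field_simps)
  hence "(\<Sum>a<t div 2 + 1. 2 * sin \<gamma> * cos (real (2 * a + 1) * \<gamma>)) = sin (2 * pi * of_int d - \<gamma>)"
    by (subst sum_cos_odd_multiples) simp
  also have "\<dots> = - sin \<gamma>"
    by (simp only: sin_diff sin_int_2pin cos_int_2pin mult_1_left mult_zero_left diff_0)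
  finally have "2 * sin \<gamma> * (\<Sum>a\<le>t div 2. cos (real (2 * a + 1) * \<gamma>)) = - sin \<gamma>"
    by (simp add: lessThan_Suc_atMost flip: sum_distrib_left)
  hence "sin \<gamma> * (2 * (\<Sum>a\<le>t div 2. cos (real (2 * a + 1) * \<gamma>))) = sin \<gamma> * (- 1)"
    by simp
  hence "2 * (\<Sum>a\<le>t div 2. cos (real (2 * a + 1) * \<gamma>)) = - 1"
    using s mult_left_cancel by blast
  hence "(\<Sum>a\<le>t div 2. cos (real (2 * a + 1) * \<gamma>)) = - 1 / 2" by linarith
  thus ?thesis by (simp add: \<gamma>_def mult_ac)
qed

lemma sin_mult_sin_half_angle:
  "sin (real m * half_angle t j) * sin (real m * half_angle t k) =
    (cos (real m * ((if even t then 1 else 2) * pi * of_int (int j - int k) / real (t + 2))) -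
     cos (real m * ((if even t then 1 else 2) * pi * of_int (int j + int k) / real (t + 2)))) / 2"
proof -
  have "(if even t then 1 else 2) * pi * of_int (int j - int k) / real (t + 2) = half_angle t j - half_angle t k"
    "(if even t then 1 else 2) * pi * of_int (int j + int k) / real (t + 2) = half_angle t j + half_angle t k"
    by (auto simp: half_angle_def diff_divide_distrib add_divide_distrib algebra_simps)
  thus ?thesis by (simp only: right_diff_distrib distrib_left cos_diff cos_add) simp
qed

lemma sum_sin_mult_sin_half_angle:
  "(\<Sum>a\<le>t div 2. sin (real (2 * a + 1) * half_angle t j) * sin (real (2 * a + 1) * half_angle t k)) =
    ((\<Sum>a\<le>t div 2. cos (real (2 * a + 1) * ((if even t then 1 else 2) * pi * of_int (int j - int k) / real (t + 2)))) -
     (\<Sum>a\<le>t div 2. cos (real (2 * a + 1) * ((if even t then 1 else 2) * pi * of_int (int j + int k) / real (t + 2))))) / 2"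
  unfolding sin_mult_sin_half_angle by (simp only: sum_divide_distrib[symmetric] sum_subtractf)

lemma not_dvd_small:
  assumes "(d::int) \<noteq> 0" "\<bar>d\<bar> < int N"
  shows "\<not> int N dvd d"
  using assms dvd_imp_le_int[of d "int N"] by auto

text \<open>Product-to-sum leaves two cosine sums, at \<open>j - k\<close> and \<open>j + k\<close>.
  Neither index is divisible by \<open>t + 2\<close>, so the sums are equal and cancel.\<close>

lemma character_orthogonal:
  assumes j: "j \<in> {1..(t + 2) div 2}" and k: "k \<in> {1..(t + 2) div 2}" and "j \<noteq> k"
  shows "(\<Sum>a\<le>t div 2. character t j a * character t k a) = 0"
proof -
  have 1: "\<not> int (t + 2) dvd int j - int k" using assms by (intro not_dvd_small) auto
  have 2: "\<not> int (t + 2) dvd int j + int k" using assms by (intro not_dvd_small) auto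
  have "(\<Sum>a\<le>t div 2. sin (real (2 * a + 1) * half_angle t j) * sin (real (2 * a + 1) * half_angle t k)) = 0"
    unfolding sum_sin_mult_sin_half_angle
    using sum_cos_odd_multiples_even[OF _ 1] sum_cos_odd_multiples_even[OF _ 2] sum_cos_odd_multiples_odd[OF _ 1] sum_cos_odd_multiples_odd[OF _ 2]
    by (cases "even t") simp_all
  hence "(\<Sum>a\<le>t div 2. sin (real (2 * a + 1) * half_angle t j) * sin (real (2 * a + 1) * half_angle t k)) /
      (sin (half_angle t j) * sin (half_angle t k)) = 0" by simp
  thus ?thesis unfolding sum_divide_distrib character_def by (simp only: times_divide_times_eq)
qed

text \<open>The same two cosine sums at the indices 0 and \<open>2 * j\<close>: the former counts
  the labels, and half the difference is \<open>(t + 2) / 4\<close>. At \<open>2 * j = t + 2\<close>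
  the second index is divisible too, and all sines square to 1.\<close>

lemma character_norm_eq:
  assumes j: "j \<in> {1..(t + 2) div 2}"
  shows "character_norm t j = (if 2 * j = t + 2 then real (t + 2) / 2 else real (t + 2) / 4 * (1 / sin (half_angle t j) ^ 2))"
proof -
  define S where "S = (\<Sum>a\<le>t div 2. sin (real (2 * a + 1) * half_angle t j) * sin (real (2 * a + 1) * half_angle t j))"
  have h: "character_norm t j = S / sin (half_angle t j) ^ 2"
    unfolding character_norm_def character_def S_def sum_divide_distrib by (simp add: power2_eq_square)
  show ?thesis
  proof (cases "2 * j = t + 2")
    case True
    hence ev: "even t" by presburger
    have t: "real t = 2 * real j - 2" using True by linarith
    have a: "half_angle t j = pi / 2" using ev True by (simp add: half_angle_def t)
    have "(sin (real (2 * a + 1) * (pi / 2))) ^ 2 = 1" for a :: nat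
    proof -
      have "cos (real (2 * a + 1) * (pi / 2)) = 0"
        by (subst cos_zero_iff) (auto intro!: exI[of _ "2 * a + 1"])
      thus ?thesis by (simp add: sin_squared_eq)
    qed
    hence "S = real (t div 2 + 1)" unfolding S_def a by (simp add: power2_eq_square)
    thus ?thesis using True ev h a by (auto simp: field_simps elim!: evenE)
  next
    case False
    have 2: "\<not> int (t + 2) dvd int j + int j" using assms False by (intro not_dvd_small) auto
    have S: "S = real (t + 2) / 4"
      using sum_cos_odd_multiples_even[OF _ 2] sum_cos_odd_multiples_odd[OF _ 2]
      unfolding S_def sum_sin_mult_sin_half_angle
      by (cases "even t") (auto simp: field_simps elim!: evenE oddE)
    show ?thesis unfolding h S using False by simp
  qed
qed

lemma character_norm_pos:
  assumes j: "j \<in> {1..(t + 2) div 2}"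
  shows "character_norm t j > 0"
  using character_norm_eq[OF j] sin_half_angle_neq_0[OF j] by simp

text \<open>With \<open>N = t + 2\<close>, the cosines over a full period of \<open>N\<close>
  indices sum to 0. Folding \<open>j\<close> with \<open>N - j\<close> gives the factor 2, the
  middle term is its own mirror image, and the term 1 at \<open>j = 0\<close> moves to the
  right.\<close>

lemma sum_cos_even_multiples_even:
  assumes "even t" "\<not> int (t + 2) dvd k"
  shows "(\<Sum>j\<in>{1..t div 2}. 2 * cos (real (2 * j) * (pi * of_int k / real (t + 2)))) + cos (pi * of_int k) = - 1"
proof -
  define \<beta> where "\<beta> = pi * of_int k / real (t + 2)"
  have s: "sin \<beta> \<noteq> 0" unfolding \<beta>_def using assms by (subst sin_pi_int_div_eq_0_iff) auto
  have "real (2 * (t div 2) + 1) = real (t + 2) - 1" using assms by auto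
  hence "real (2 * (t div 2) + 1) * \<beta> = pi * of_int k - \<beta>"
    by (simp only: \<beta>_def) (simp add: field_simps)
  hence "(\<Sum>j\<in>{1..t div 2}. 2 * sin \<beta> * cos (real (2 * j) * \<beta>)) = sin (pi * of_int k - \<beta>) - sin \<beta>"
    by (subst sum_cos_even_multiples) simp
  also have "sin (pi * of_int k) = 0" using sin_zero_iff_int2[of "pi * of_int k"] by (simp add: mult.commute)
  hence "sin (pi * of_int k - \<beta>) = - cos (pi * of_int k) * sin \<beta>" by (simp add: sin_diff)
  finally have "sin \<beta> * ((\<Sum>j\<in>{1..t div 2}. 2 * cos (real (2 * j) * \<beta>)) + cos (pi * of_int k)) = sin \<beta> * (- 1)"
    by (simp add: sum_distrib_left algebra_simps)
  thus ?thesis unfolding \<beta>_def[symmetric] using s mult_left_cancel by blast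
qed

lemma sum_cos_even_multiples_odd:
  assumes "odd t" "\<not> int (t + 2) dvd k"
  shows "(\<Sum>j\<in>{1..t div 2 + 1}. 2 * cos (real (2 * j) * (2 * pi * of_int k / real (t + 2)))) = - 1"
proof -
  define \<beta> where "\<beta> = pi * of_int (2 * k) / real (t + 2)"
  have "coprime (int (t + 2)) 2" using assms by (simp add: coprime_commute)
  hence "\<not> int (t + 2) dvd 2 * k" using assms by (simp add: coprime_dvd_mult_right_iff)
  hence s: "sin \<beta> \<noteq> 0" unfolding \<beta>_def by (subst sin_pi_int_div_eq_0_iff) auto
  have "real (2 * (t div 2 + 1) + 1) = real (t + 2)" using assms by (auto elim!: oddE)
  hence "real (2 * (t div 2 + 1) + 1) * \<beta> = 2 * pi * of_int k"
    by (simp only: \<beta>_def) (simp add: field_simps)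
  hence "(\<Sum>j\<in>{1..t div 2 + 1}. 2 * sin \<beta> * cos (real (2 * j) * \<beta>)) = sin (2 * pi * of_int k) - sin \<beta>"
    by (subst sum_cos_even_multiples) simp
  moreover have "(\<Sum>j\<in>{1..t div 2 + 1}. 2 * sin \<beta> * cos (real (2 * j) * \<beta>)) =
      sin \<beta> * (\<Sum>j\<in>{1..t div 2 + 1}. 2 * cos (real (2 * j) * \<beta>))"
    unfolding sum_distrib_left by (intro sum.cong) auto
  ultimately have "sin \<beta> * (\<Sum>j\<in>{1..t div 2 + 1}. 2 * cos (real (2 * j) * \<beta>)) = sin \<beta> * (- 1)"
    by (simp only: sin_int_2pin)
  hence "(\<Sum>j\<in>{1..t div 2 + 1}. 2 * cos (real (2 * j) * \<beta>)) = - 1"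
    using s mult_left_cancel by blast
  thus ?thesis by (simp add: \<beta>_def mult_ac)
qed

text \<open>The second orthogonality relation, by the computation for the first with label and
  character exchanged: dividing by the norm cancels the squared sine and leaves cosine sums over
  \<open>j\<close>.\<close>

lemma character_complete:
  assumes a: "a \<le> t div 2" and b: "b \<le> t div 2"
  shows "(\<Sum>j\<in>{1..(t + 2) div 2}. character t j a * character t j b / character_norm t j) = of_bool (a = b)"
proof -
  define N where "N = real (t + 2)"
  define d1 where "d1 = int a - int b"
  define d2 where "d2 = int a + int b + 1"
  have nd2: "\<not> int (t + 2) dvd d2" using a b unfolding d2_def by (intro not_dvd_small) auto
  have nd1: "\<not> int (t + 2) dvd d1" if "a \<noteq> b" using a b that unfolding d1_def by (intro not_dvd_small) auto
  have ss: "sin (real (2 * a + 1) * half_angle t j) * sin (real (2 * b + 1) * half_angle t j) =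
      (cos (of_int (2 * d1) * half_angle t j) - cos (of_int (2 * d2) * half_angle t j)) / 2" for j
  proof -
    have "of_int (2 * d1) * half_angle t j = real (2 * a + 1) * half_angle t j - real (2 * b + 1) * half_angle t j"
      "of_int (2 * d2) * half_angle t j = real (2 * a + 1) * half_angle t j + real (2 * b + 1) * half_angle t j"
      by (simp_all add: d1_def d2_def algebra_simps)
    thus ?thesis by (simp only: cos_diff cos_add) simp
  qed
  have character_div: "character t j a * character t j b / character_norm t j =
      (if 2 * j = t + 2 then 1 else 2) / N * (cos (of_int (2 * d1) * half_angle t j) - cos (of_int (2 * d2) * half_angle t j))"
    if j: "j \<in> {1..(t + 2) div 2}" for j
  proof -
    have s: "sin (half_angle t j) \<noteq> 0" by (rule sin_half_angle_neq_0[OF j])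
    have 1: "character t j a * character t j b = (cos (of_int (2 * d1) * half_angle t j) - cos (of_int (2 * d2) * half_angle t j)) / 2 / sin (half_angle t j) ^ 2"
      unfolding character_def ss[symmetric] by (simp add: power2_eq_square)
    show ?thesis
    proof (cases "2 * j = t + 2")
      case True
      hence ev: "even t" by presburger
      have t: "real t = 2 * real j - 2" using True by linarith
      have "half_angle t j = pi / 2" using ev True by (simp add: half_angle_def t)
      hence "sin (half_angle t j) = 1" by (simp only: sin_pi_half)
      thus ?thesis unfolding 1 character_norm_eq[OF j] using True by (simp add: N_def field_simps)
    next
      case False
      have "X / 2 / s ^ 2 / (N / 4 * (1 / s ^ 2)) = 2 / N * X" if "s \<noteq> 0" for X s :: real
        using that by (simp add: field_simps)
      from this[OF s] show ?thesis unfolding 1 character_norm_eq[OF j] N_def[symmetric] using False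
        by (simp only: if_False)
    qed
  qed
  \<comment> \<open>With weight 1 at the middle index and 2 elsewhere, \<open>C d\<close> amounts to
    a sum over all nonzero residues modulo \<open>N\<close>: -1 if \<open>N\<close> does not divide
    \<open>d\<close>, and \<open>N - 1\<close> for \<open>d = 0\<close>.\<close>
  define C where "C = (\<lambda>d::int. \<Sum>j\<in>{1..(t + 2) div 2}. (if 2 * j = t + 2 then 1 else 2) * cos (of_int (2 * d) * half_angle t j))"
  have C: "C d = - 1" if "\<not> int (t + 2) dvd d" for d
  proof (cases "even t")
    case True
    have "{1..(t + 2) div 2} = insert (t div 2 + 1) {1..t div 2}" by auto
    hence "C d = (\<Sum>j\<in>{1..t div 2}. (if 2 * j = t + 2 then 1 else 2) * cos (of_int (2 * d) * half_angle t j)) +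
       (if 2 * (t div 2 + 1) = t + 2 then 1 else 2) * cos (of_int (2 * d) * half_angle t (t div 2 + 1))"
      unfolding C_def by simp
    also have "(\<Sum>j\<in>{1..t div 2}. (if 2 * j = t + 2 then 1 else 2) * cos (of_int (2 * d) * half_angle t j)) =
       (\<Sum>j\<in>{1..t div 2}. 2 * cos (real (2 * j) * (pi * of_int d / real (t + 2))))"
      using True by (intro sum.cong refl) (auto simp: half_angle_def mult_ac)
    also have "real (t div 2 + 1) * 2 = real (t + 2)" using True by auto
    hence "of_int (2 * d) * half_angle t (t div 2 + 1) = pi * of_int d"
      using True unfolding half_angle_def by (simp add: field_simps)
    also have "(if 2 * (t div 2 + 1) = t + 2 then 1 else 2) = (1::real)" using True by auto
    finally show ?thesis using sum_cos_even_multiples_even[OF True that] by simp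
  next
    case False
    have "2 * j \<noteq> t + 2" for j using False by presburger
    hence "C d = (\<Sum>j\<in>{1..t div 2 + 1}. 2 * cos (real (2 * j) * (2 * pi * of_int d / real (t + 2))))"
      unfolding C_def using False by (intro sum.cong) (auto simp: half_angle_def mult_ac)
    thus ?thesis using sum_cos_even_multiples_odd[OF False that] by simp
  qed
  have C0: "C 0 = N - 1"
  proof (cases "even t")
    case True
    have "{1..(t + 2) div 2} = insert (t div 2 + 1) {1..t div 2}" by auto
    hence "C 0 = (\<Sum>j\<in>{1..t div 2}. (if 2 * j = t + 2 then 1 else 2)) +
       (if 2 * (t div 2 + 1) = t + 2 then 1 else 2)"
      unfolding C_def by simp
    also have "(\<Sum>j\<in>{1..t div 2}. (if 2 * j = t + 2 then 1 else 2 :: real)) = (\<Sum>j\<in>{1..t div 2}. 2)"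
      by (intro sum.cong refl) auto
    finally show ?thesis using True by (auto simp: N_def elim!: evenE)
  next
    case False
    have "2 * j \<noteq> t + 2" for j using False by presburger
    thus ?thesis unfolding C_def N_def using False by (auto elim!: oddE)
  qed
  have "(\<Sum>j\<in>{1..(t + 2) div 2}. character t j a * character t j b / character_norm t j) =
      (\<Sum>j\<in>{1..(t + 2) div 2}. (if 2 * j = t + 2 then 1 else 2) / N * (cos (of_int (2 * d1) * half_angle t j) - cos (of_int (2 * d2) * half_angle t j)))"
    by (intro sum.cong refl character_div)
  also have "\<dots> = (C d1 - C d2) / N"
    unfolding C_def sum_subtractf[symmetric] sum_divide_distrib by (intro sum.cong refl) (simp add: right_diff_distrib diff_divide_distrib)
  also have "\<dots> = of_bool (a = b)"
    using C[OF nd2] C[OF nd1] C0 by (cases "a = b") (simp_all add: d1_def N_def)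
  finally show ?thesis .
qed

text \<open>Verlinde's formula: multiplying out the first two characters and applying completeness
  isolates the structure constant at \<open>c\<close>.\<close>

lemma admissible_spectral:
  assumes a: "a \<le> t div 2" and b: "b \<le> t div 2" and c: "c \<le> t div 2"
  shows "of_bool (admissible t a b c) =
    (\<Sum>j\<in>{1..(t + 2) div 2}. character t j a * character t j b * character t j c / character_norm t j)"
proof -
  have "(\<Sum>j\<in>{1..(t + 2) div 2}. character t j a * character t j b * character t j c / character_norm t j) =
     (\<Sum>j\<in>{1..(t + 2) div 2}. \<Sum>d\<le>t div 2. of_bool (admissible t a b d) * (character t j d * character t j c / character_norm t j))"
    by (intro sum.cong refl, subst character_mult[OF _ a b])
       (simp_all only: sum_distrib_right sum_divide_distrib mult.assoc times_divide_eq_right)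
  also have "\<dots> = (\<Sum>d\<le>t div 2. of_bool (admissible t a b d) * (\<Sum>j\<in>{1..(t + 2) div 2}. character t j d * character t j c / character_norm t j))"
    by (subst sum.swap) (simp only: sum_distrib_left)
  also have "\<dots> = (\<Sum>d\<le>t div 2. of_bool (admissible t a b d) * of_bool (d = c))"
    by (intro sum.cong refl) (use c in \<open>simp only: character_complete atMost_iff\<close>)
  also have "\<dots> = (\<Sum>d\<le>t div 2. if d = c then of_bool (admissible t a b d) else 0)"
    by (intro sum.cong refl) auto
  also have "\<dots> = of_bool (admissible t a b c)" using c by (simp add: sum.delta)
  finally show ?thesis ..
qed

section \<open>Lattice points as a sum over characters\<close>

lemma one_three_graphD:
  assumes "one_three_graph G"
  shows "finite (nodes G)" "finite (edges G)" "finite (internal_nodes G)"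
    "e \<in> edges G \<Longrightarrow> size (ends G e) = 2" "e \<in> edges G \<Longrightarrow> v \<in># ends G e \<Longrightarrow> v \<in> nodes G"
    "v \<in> nodes G \<Longrightarrow> v \<notin> internal_nodes G \<Longrightarrow> degree_mg G v = 1"
    "v \<in> internal_nodes G \<Longrightarrow> degree_mg G v = 3"
    "v \<in> internal_nodes G \<Longrightarrow> v \<in> nodes G"
  using assms by (auto simp: one_three_graph_def finite_mgraph_def internal_nodes_def)

lemma ends_pairE:
  assumes "one_three_graph G" "e \<in> edges G"
  obtains u v where "ends G e = {#u, v#}" "u \<in> nodes G" "v \<in> nodes G"
proof -
  have "size (ends G e) = Suc (Suc 0)" using one_three_graphD(4)[OF assms] by simp
  then obtain u v where "ends G e = {#u, v#}"
    by (auto elim!: size_mset_SucE)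
  with one_three_graphD(5)[OF assms] show thesis by (intro that[of u v]) auto
qed

lemma leaf_edge_unique:
  assumes fin: "finite (edges G)" and deg: "degree_mg G v = 1"
    and e: "e \<in> edges G" "v \<in># ends G e" and f: "f \<in> edges G" "v \<in># ends G f"
  shows "e = f" "count (ends G e) v = 1"
proof -
  have pos: "count (ends G e) v \<ge> 1" "count (ends G f) v \<ge> 1"
    using e(2) f(2) by (auto simp: Suc_le_eq)
  show "e = f"
  proof (rule ccontr)
    assume "e \<noteq> f"
    hence "count (ends G e) v + count (ends G f) v = (\<Sum>x\<in>{e, f}. count (ends G x) v)" by simp
    also have "\<dots> \<le> degree_mg G v"
      unfolding degree_mg_def using fin e f by (intro sum_mono2) auto
    finally show False using pos deg by simp
  qed
  have "count (ends G e) v \<le> degree_mg G v"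
    unfolding degree_mg_def using member_le_sum[OF e(1), of "\<lambda>x. count (ends G x) v"] fin by simp
  thus "count (ends G e) v = 1" using pos(1) deg by linarith
qed

lemma leaf_neighbour_unique:
  assumes "finite (edges G)" "degree_mg G u = 1" "(u, v) \<in> adjacency G" "(u, w) \<in> adjacency G"
  shows "v = w"
proof -
  obtain e f where ef: "e \<in> edges G" "ends G e = {#u, v#}" "f \<in> edges G" "ends G f = {#u, w#}"
    using assms(3,4) by (auto simp: adjacency_def)
  hence "e = f" using leaf_edge_unique(1)[OF assms(1,2), of e f] by simp
  thus ?thesis using ef by simp
qed

lemma adjacency_sym: "(u, v) \<in> adjacency G \<Longrightarrow> (v, u) \<in> adjacency G"
  by (auto simp: adjacency_def add_mset_commute)

text \<open>Two leaves joined by an edge have no other neighbours, so they would form a whole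
  component without an internal node.\<close>

lemma edge_meets_internal:
  assumes G: "one_three_graph G" "connected_mgraph G" and "internal_nodes G \<noteq> {}" and e: "e \<in> edges G"
    and ends: "ends G e = {#u, v#}"
  shows "u \<in> internal_nodes G \<or> v \<in> internal_nodes G"
proof (rule ccontr)
  assume *: "\<not> ?thesis"
  note D = one_three_graphD[OF G(1)]
  have uv: "u \<in> nodes G" "v \<in> nodes G" using D(5)[OF e] ends by auto
  hence deg: "degree_mg G u = 1" "degree_mg G v = 1" using D(6) * by auto
  have adj: "(u, v) \<in> adjacency G" using e ends by (auto simp: adjacency_def)
  obtain w where w: "w \<in> internal_nodes G" using assms(3) by auto
  have "(u, w) \<in> (adjacency G)\<^sup>*" using G(2) uv w D(8) by (auto simp: connected_mgraph_def)
  hence "w = u \<or> w = v"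
  proof (induction rule: rtrancl_induct)
    case (step y z)
    thus ?case
      using leaf_neighbour_unique[OF D(2) deg(1) adj] leaf_neighbour_unique[OF D(2) deg(2) adjacency_sym[OF adj]]
      by auto
  qed simp
  thus False using w * by auto
qed

text \<open>By connectedness such an edge would be the only one, and its two ends cannot give an
  internal node degree 3.\<close>

lemma no_component_edge:
  assumes G: "one_three_graph G" "connected_mgraph G" and "internal_nodes G \<noteq> {}"
  shows "\<not> is_component_edge G e"
proof
  assume "is_component_edge G e"
  note D = one_three_graphD[OF G(1)]
  obtain u where u: "u \<in> nodes G" and eq: "{f \<in> edges G. set_mset (ends G f) \<subseteq> component_of G u} = {e}"
    using \<open>is_component_edge G e\<close> by (auto simp: is_component_edge_def)
  have "component_of G u = nodes G" using G(2) u by (auto simp: component_of_def connected_mgraph_def)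
  hence "edges G = {e}" using eq D(5) by auto
  moreover obtain v where v: "v \<in> internal_nodes G" using assms(3) by auto
  ultimately have "count (ends G e) v = 3" using D(7)[OF v] by (simp add: degree_mg_def)
  moreover have "count (ends G e) v \<le> size (ends G e)" by (rule count_le_size)
  ultimately show False using D(4)[of e] \<open>edges G = {e}\<close> by simp
qed

text \<open>Serves to write a product over the three edges at a node, listed with multiplicity, as a
  product over all edges with the incidence count as exponent. In this form products over nodes and
  edges can be exchanged.\<close>

lemma prod_mset_sum_replicate:
  fixes f :: "'e \<Rightarrow> 'a :: comm_semiring_1"
  assumes "finite A"
  shows "prod_mset (image_mset f (\<Sum>e\<in>A. replicate_mset (k e) e)) = (\<Prod>e\<in>A. f e ^ k e)"
  using assms by (induction A rule: finite_induct) auto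

lemma size_incident_edges:
  fixes G :: "('v, 'e) mgraph"
  assumes "finite (edges G)"
  shows "size (incident_edges G v) = degree_mg G v"
proof -
  have "size (\<Sum>e\<in>A. replicate_mset (k e) e) = (\<Sum>e\<in>A. k e)" if "finite A" for A and k :: "'e \<Rightarrow> nat"
    using that by (induction A rule: finite_induct) auto
  from this[OF assms] show ?thesis unfolding incident_edges_def degree_mg_def .
qed

lemma incident_edges_tripleE:
  assumes "one_three_graph G" "v \<in> internal_nodes G"
  obtains a b c where "incident_edges G v = {#a, b, c#}"
proof -
  have "size (incident_edges G v) = Suc (Suc (Suc 0))"
    using size_incident_edges[OF one_three_graphD(2)[OF assms(1)], of v] one_three_graphD(7)[OF assms] by simp
  then obtain a b c where "incident_edges G v = {#a, b, c#}"
    by (auto elim!: size_mset_SucE)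
  thus thesis by (rule that)
qed

lemma set_mset_incident_edges:
  fixes G :: "('v, 'e) mgraph"
  assumes "finite (edges G)"
  shows "set_mset (incident_edges G v) = {e \<in> edges G. v \<in># ends G e}"
proof -
  have "set_mset (\<Sum>e\<in>A. replicate_mset (k e) e) = {e \<in> A. k e > 0}" if "finite A" for A and k :: "'e \<Rightarrow> nat"
    using that
  proof (induction A rule: finite_induct)
    case (insert x F)
    have "{e \<in> insert x F. k e > 0} = (if k x = 0 then {} else {x}) \<union> {e \<in> F. k e > 0}" by auto
    thus ?case using insert by simp
  qed simp
  from this[OF assms] show ?thesis unfolding incident_edges_def by simp
qed

text \<open>The range is forced at a node: \<open>a \<le> b + c\<close> and
  \<open>a + b + c \<le> t\<close> give \<open>2 * a \<le> t\<close>. Building it in makes the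
  labels the basis of the fusion algebra.\<close>

definition labellings :: "('v, 'e) mgraph \<Rightarrow> nat \<Rightarrow> ('e \<Rightarrow> nat) set" where
  "labellings G t = {w \<in> edges G \<rightarrow>\<^sub>E {..t div 2}. \<forall>v\<in>internal_nodes G. \<forall>a b c.
     incident_edges G v = {#a, b, c#} \<longrightarrow> admissible t (w a) (w b) (w c)}"

lemma ehrhart_eq_card_labellings:
  fixes G :: "('v, 'e) mgraph"
  assumes G: "one_three_graph G" "connected_mgraph G" and ne: "internal_nodes G \<noteq> {}"
  shows "ehrhart_P G t = card (labellings G t)"
proof -
  let ?E = "edges G"
  note D = one_three_graphD[OF G(1)]
  define \<iota> where "\<iota> = (\<lambda>(w :: 'e \<Rightarrow> nat). \<lambda>e\<in>?E. real (w e))"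
  have inc: "a \<in> ?E" "b \<in> ?E" "c \<in> ?E" if "incident_edges G v = {#a, b, c#}" for v a b c
    using set_mset_incident_edges[OF D(2), of v] that by auto
  have "dilate ?E (real t) (polytope_P G) \<inter> (?E \<rightarrow>\<^sub>E \<int>) = \<iota> ` labellings G t"
  proof (intro equalityI subsetI)
    fix u assume "u \<in> \<iota> ` labellings G t"
    then obtain w where w: "w \<in> labellings G t" and u: "u = \<iota> w" by auto
    \<comment> \<open>At \<open>t = 0\<close> the quotients are 0 by convention, which agrees with
      the zero labelling, the only one then.\<close>
    define p where "p = (\<lambda>e\<in>?E. real (w e) / real t)"
    have "p \<in> polytope_P G"
      unfolding polytope_P_def
    proof (intro CollectI conjI ballI allI impI)
      show "p \<in> ?E \<rightarrow>\<^sub>E UNIV" by (auto simp: p_def)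
    next
      fix e assume "is_component_edge G e"
      thus "0 \<le> p e" "p e \<le> 1 / 2" using no_component_edge[OF G ne] by auto
    next
      fix v a b c assume v: "v \<in> internal_nodes G" "incident_edges G v = {#a, b, c#}"
      have "admissible t (w a) (w b) (w c)" using w v by (auto simp: labellings_def)
      hence r: "real (w a) \<le> real (w b) + real (w c)" "real (w b) \<le> real (w a) + real (w c)"
        "real (w c) \<le> real (w a) + real (w b)" "real (w a) + real (w b) + real (w c) \<le> real t"
        unfolding admissible_def by linarith+
      have p: "p a = real (w a) / real t" "p b = real (w b) / real t" "p c = real (w c) / real t"
        using inc[OF v(2)] by (auto simp: p_def)
      show "p a \<le> p b + p c" "p b \<le> p a + p c" "p c \<le> p a + p b"
        unfolding p add_divide_distrib[symmetric] using r by (auto intro!: divide_right_mono)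
      show "p a + p b + p c \<le> 1"
        unfolding p add_divide_distrib[symmetric] using r(4)
        by (cases "t = 0") (auto simp: divide_le_eq_1)
    qed
    moreover have "u = (\<lambda>e\<in>?E. real t * p e)"
      using w by (auto simp: u \<iota>_def p_def labellings_def fun_eq_iff PiE_def Pi_def)
    ultimately have "u \<in> dilate ?E (real t) (polytope_P G)" by (auto simp: dilate_def)
    moreover have "u \<in> ?E \<rightarrow>\<^sub>E \<int>" by (auto simp: u \<iota>_def)
    ultimately show "u \<in> dilate ?E (real t) (polytope_P G) \<inter> (?E \<rightarrow>\<^sub>E \<int>)" by blast
  next
    fix u assume "u \<in> dilate ?E (real t) (polytope_P G) \<inter> (?E \<rightarrow>\<^sub>E \<int>)"
    then obtain p where p: "p \<in> polytope_P G" and u: "u = (\<lambda>e\<in>?E. real t * p e)"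
      and uZ: "u \<in> ?E \<rightarrow>\<^sub>E \<int>" by (auto simp: dilate_def)
    have tri_u: "u a \<le> u b + u c" "u b \<le> u a + u c" "u c \<le> u a + u b" "u a + u b + u c \<le> real t"
      if v: "v \<in> internal_nodes G" "incident_edges G v = {#a, b, c#}" for v a b c
    proof -
      have r: "p a \<le> p b + p c" "p b \<le> p a + p c" "p c \<le> p a + p b" "p a + p b + p c \<le> 1"
        using p v unfolding polytope_P_def by blast+
      have eq: "u a = real t * p a" "u b = real t * p b" "u c = real t * p c"
        using inc[OF v(2)] by (auto simp: u)
      show "u a \<le> u b + u c" "u b \<le> u a + u c" "u c \<le> u a + u b"
        unfolding eq distrib_left[symmetric] using r by (auto intro!: mult_left_mono)
      show "u a + u b + u c \<le> real t"
        unfolding eq distrib_left[symmetric] using mult_left_mono[OF r(4), of "real t"] by simp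
    qed
    \<comment> \<open>Adding two triangle inequalities gives nonnegativity, adding one to the bound
      on the sum gives the upper bound; every edge has an internal end where these hold.\<close>
    have range: "u e \<ge> 0" "2 * u e \<le> real t" if e: "e \<in> ?E" for e
    proof -
      obtain x y where xy: "ends G e = {#x, y#}" using ends_pairE[OF G(1) e] by metis
      obtain v where v: "v \<in> internal_nodes G" "v \<in># ends G e"
        using edge_meets_internal[OF G ne e xy] xy by auto
      obtain a b c where abc: "incident_edges G v = {#a, b, c#}"
        using incident_edges_tripleE[OF G(1) v(1)] by metis
      have "e = a \<or> e = b \<or> e = c"
        using set_mset_incident_edges[OF D(2), of v] e v(2) by (auto simp: abc)
      thus "u e \<ge> 0" "2 * u e \<le> real t" using tri_u[OF v(1) abc] by auto
    qed
    define w where "w = (\<lambda>e\<in>?E. nat \<lfloor>u e\<rfloor>)"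
    have wu: "real (w e) = u e" if e: "e \<in> ?E" for e
    proof -
      have "u e \<in> \<int>" using uZ e by auto
      then obtain k :: int where k: "u e = of_int k" by (auto elim: Ints_cases)
      thus ?thesis using range(1)[OF e] e by (simp add: w_def)
    qed
    have "w \<in> labellings G t"
      unfolding labellings_def
    proof (intro CollectI conjI ballI allI impI PiE_I)
      fix e assume e: "e \<in> ?E"
      have "2 * w e \<le> t" using range(2)[OF e] wu[OF e] by linarith
      thus "w e \<in> {..t div 2}" by simp
    next
      fix e assume "e \<notin> ?E"
      thus "w e = undefined" by (simp add: w_def)
    next
      fix v a b c assume v: "v \<in> internal_nodes G" "incident_edges G v = {#a, b, c#}"
      show "admissible t (w a) (w b) (w c)"
        using tri_u[OF v] wu[OF inc(1)[OF v(2)]] wu[OF inc(2)[OF v(2)]] wu[OF inc(3)[OF v(2)]]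
        unfolding admissible_def by linarith
    qed
    moreover have "u = \<iota> w"
    proof
      fix e show "u e = \<iota> w e" using wu[of e] by (cases "e \<in> ?E") (simp_all add: \<iota>_def u)
    qed
    ultimately show "u \<in> \<iota> ` labellings G t" by blast
  qed
  moreover have "inj_on \<iota> (labellings G t)"
  proof (rule inj_onI)
    fix w w' assume w: "w \<in> labellings G t" "w' \<in> labellings G t" and eq: "\<iota> w = \<iota> w'"
    show "w = w'"
    proof (rule PiE_ext[of w ?E "\<lambda>_. {..t div 2}" w'])
      fix e assume "e \<in> ?E"
      thus "w e = w' e" using fun_cong[OF eq, of e] by (simp add: \<iota>_def)
    qed (use w in \<open>auto simp: labellings_def\<close>)
  qed
  ultimately show ?thesis unfolding ehrhart_P_def by (simp add: card_image)
qed

definition inner_edges :: "('v, 'e) mgraph \<Rightarrow> 'e set" where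
  "inner_edges G = {e \<in> edges G. set_mset (ends G e) \<subseteq> internal_nodes G}"

definition pendant_edges :: "('v, 'e) mgraph \<Rightarrow> 'e set" where
  "pendant_edges G = edges G - inner_edges G"

lemma prod_of_bool: "finite A \<Longrightarrow> (\<Prod>x\<in>A. of_bool (P x)) = (of_bool (\<forall>x\<in>A. P x) :: 'a :: comm_semiring_1)"
  by (induction A rule: finite_induct) auto

lemma prod_power_count_pair:
  fixes g :: "'v \<Rightarrow> 'a :: comm_semiring_1"
  assumes "finite A"
  shows "(\<Prod>x\<in>A. g x ^ count {#u, v#} x) = (if u \<in> A then g u else 1) * (if v \<in> A then g v else 1)"
proof -
  have "(\<Prod>x\<in>A. g x ^ count {#u, v#} x) = (\<Prod>x\<in>A. (if x = u then g x else 1) * (if x = v then g x else 1))"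
    by (intro prod.cong refl) auto
  also have "\<dots> = (if u \<in> A then g u else 1) * (if v \<in> A then g v else 1)"
    using assms by (simp add: prod.distrib prod.delta)
  finally show ?thesis .
qed

text \<open>Expanding every node indicator turns the count into a sum over assignments \<open>\<phi>\<close> of characters to
  internal nodes. An edge between nodes with different characters contributes 0 by orthogonality, so
  only the constant \<open>\<phi>\<close> survive in a connected graph.\<close>

lemma card_labellings_spectral:
  assumes G: "one_three_graph G" "connected_mgraph G" and ne: "internal_nodes G \<noteq> {}"
  shows "real (card (labellings G t)) = (\<Sum>j\<in>{1..(t + 2) div 2}.
    character_norm t j ^ card (inner_edges G) * leaf_sum t j ^ card (pendant_edges G) /
    character_norm t j ^ card (internal_nodes G))"
proof -
  let ?E = "edges G" and ?I = "internal_nodes G" and ?H = "{..t div 2}"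
  let ?J = "{1..(t + 2) div 2}"
  note D = one_three_graphD[OF G(1)]
  define cnt where "cnt = (\<lambda>e v. count (ends G e) v)"
  define loc where "loc = (\<lambda>v w. \<forall>a b c. incident_edges G v = {#a, b, c#} \<longrightarrow> admissible t (w a) (w b) (w c))"
  \<comment> \<open>The total weight of an edge once a character is fixed at every internal node;
    the exponent makes a loop count twice.\<close>
  define W where "W = (\<lambda>\<phi> e. \<Sum>a\<in>?H. \<Prod>v\<in>?I. character t (\<phi> v) a ^ cnt e v)"
  have loc: "of_bool (loc v w) = (\<Sum>j\<in>?J. (\<Prod>e\<in>?E. character t j (w e) ^ cnt e v) / character_norm t j)"
    if v: "v \<in> ?I" and w: "w \<in> ?E \<rightarrow>\<^sub>E ?H" for v w
  proof -
    have admissible: "of_bool (admissible t (w a) (w b) (w c)) = (\<Sum>j\<in>?J. (\<Prod>e\<in>?E. character t j (w e) ^ cnt e v) / character_norm t j)"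
      if abc: "incident_edges G v = {#a, b, c#}" for a b c
    proof -
      have "a \<in> ?E" "b \<in> ?E" "c \<in> ?E"
        using set_mset_incident_edges[OF D(2), of v] abc by auto
      hence "w a \<le> t div 2" "w b \<le> t div 2" "w c \<le> t div 2" using w by auto
      note admissible_spectral[OF this]
      moreover have "character t j (w a) * character t j (w b) * character t j (w c) = (\<Prod>e\<in>?E. character t j (w e) ^ cnt e v)" for j
        using prod_mset_sum_replicate[OF D(2), of "\<lambda>e. character t j (w e)" "\<lambda>e. cnt e v"] abc
        unfolding incident_edges_def cnt_def by (simp add: mult_ac)
      ultimately show ?thesis by simp
    qed
    obtain a b c where abc: "incident_edges G v = {#a, b, c#}"
      using incident_edges_tripleE[OF G(1) v] by metis
    \<comment> \<open>\<open>loc\<close> quantifies over all listings of the three edges. They agree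
      because the spectral sum depends only on the incidence counts at \<open>v\<close>.\<close>
    have "admissible t (w a') (w b') (w c') \<longleftrightarrow> admissible t (w a) (w b) (w c)" if "incident_edges G v = {#a', b', c'#}" for a' b' c'
    proof -
      have "of_bool (admissible t (w a') (w b') (w c')) = (of_bool (admissible t (w a) (w b) (w c)) :: real)"
        unfolding admissible[OF abc] admissible[OF that] ..
      thus ?thesis by (simp only: of_bool_eq_iff)
    qed
    hence "loc v w \<longleftrightarrow> admissible t (w a) (w b) (w c)"
      unfolding loc_def using abc by blast
    thus ?thesis using admissible[OF abc] by simp
  qed
  have "real (card (labellings G t)) = (\<Sum>w\<in>?E \<rightarrow>\<^sub>E ?H. of_bool (\<forall>v\<in>?I. loc v w))"
  proof -
    have "labellings G t = (?E \<rightarrow>\<^sub>E ?H) \<inter> {w. \<forall>v\<in>?I. loc v w}"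
      by (auto simp: labellings_def loc_def)
    thus ?thesis using D(2) by (simp add: finite_PiE)
  qed
  also have "\<dots> = (\<Sum>w\<in>?E \<rightarrow>\<^sub>E ?H. \<Prod>v\<in>?I. \<Sum>j\<in>?J. (\<Prod>e\<in>?E. character t j (w e) ^ cnt e v) / character_norm t j)"
    using D(3) by (intro sum.cong refl) (simp add: loc flip: prod_of_bool)
  \<comment> \<open>Distributing the product means choosing a character index
    \<open>\<phi> v\<close> at each internal node. For fixed \<open>\<phi>\<close> the labels of
    different edges are independent, so the sum over \<open>w\<close> will factor over the
    edges.\<close>
  also have "\<dots> = (\<Sum>w\<in>?E \<rightarrow>\<^sub>E ?H. \<Sum>\<phi>\<in>?I \<rightarrow>\<^sub>E ?J. \<Prod>v\<in>?I. (\<Prod>e\<in>?E. character t (\<phi> v) (w e) ^ cnt e v) / character_norm t (\<phi> v))"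
    using D(3) by (intro sum.cong refl prod_sum_PiE) auto
  also have "\<dots> = (\<Sum>\<phi>\<in>?I \<rightarrow>\<^sub>E ?J. (\<Prod>e\<in>?E. W \<phi> e) / (\<Prod>v\<in>?I. character_norm t (\<phi> v)))"
  proof (subst sum.swap, intro sum.cong refl)
    fix \<phi>
    have "(\<Sum>w\<in>?E \<rightarrow>\<^sub>E ?H. \<Prod>v\<in>?I. (\<Prod>e\<in>?E. character t (\<phi> v) (w e) ^ cnt e v) / character_norm t (\<phi> v)) =
        (\<Sum>w\<in>?E \<rightarrow>\<^sub>E ?H. \<Prod>e\<in>?E. \<Prod>v\<in>?I. character t (\<phi> v) (w e) ^ cnt e v) / (\<Prod>v\<in>?I. character_norm t (\<phi> v))"
      unfolding sum_divide_distrib by (intro sum.cong refl, subst prod_dividef, subst prod.swap) simp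
    also have "(\<Sum>w\<in>?E \<rightarrow>\<^sub>E ?H. \<Prod>e\<in>?E. \<Prod>v\<in>?I. character t (\<phi> v) (w e) ^ cnt e v) = (\<Prod>e\<in>?E. W \<phi> e)"
      unfolding W_def using D(2) by (intro prod_sum_PiE[symmetric]) auto
    finally show "(\<Sum>w\<in>?E \<rightarrow>\<^sub>E ?H. \<Prod>v\<in>?I. (\<Prod>e\<in>?E. character t (\<phi> v) (w e) ^ cnt e v) / character_norm t (\<phi> v)) =
        (\<Prod>e\<in>?E. W \<phi> e) / (\<Prod>v\<in>?I. character_norm t (\<phi> v))" .
  qed
  also have "\<dots> = (\<Sum>\<phi>\<in>(\<lambda>j. \<lambda>v\<in>?I. j) ` ?J. (\<Prod>e\<in>?E. W \<phi> e) / (\<Prod>v\<in>?I. character_norm t (\<phi> v)))"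
  proof (rule sum.mono_neutral_right)
    show "finite (?I \<rightarrow>\<^sub>E ?J)" using D(3) by (intro finite_PiE) auto
    show "(\<lambda>j. \<lambda>v\<in>?I. j) ` ?J \<subseteq> ?I \<rightarrow>\<^sub>E ?J" by auto
    show "\<forall>\<phi>\<in>(?I \<rightarrow>\<^sub>E ?J) - (\<lambda>j. \<lambda>v\<in>?I. j) ` ?J. (\<Prod>e\<in>?E. W \<phi> e) / (\<Prod>v\<in>?I. character_norm t (\<phi> v)) = 0"
    proof (rule ballI, rule ccontr)
      fix \<phi> assume phi: "\<phi> \<in> (?I \<rightarrow>\<^sub>E ?J) - (\<lambda>j. \<lambda>v\<in>?I. j) ` ?J"
        and nz: "(\<Prod>e\<in>?E. W \<phi> e) / (\<Prod>v\<in>?I. character_norm t (\<phi> v)) \<noteq> 0"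
      have phiJ: "\<phi> v \<in> ?J" if "v \<in> ?I" for v using phi that by auto
      have adj: "\<phi> u = \<phi> v" if uv: "u \<in> ?I" "v \<in> ?I" "(u, v) \<in> adjacency G" for u v
      proof (rule ccontr)
        assume neq: "\<phi> u \<noteq> \<phi> v"
        obtain e where e: "e \<in> ?E" "ends G e = {#u, v#}" using uv(3) by (auto simp: adjacency_def)
        have "W \<phi> e = (\<Sum>a\<in>?H. character t (\<phi> u) a * character t (\<phi> v) a)"
          unfolding W_def cnt_def e(2) prod_power_count_pair[OF D(3)] using uv(1,2) by simp
        also have "\<dots> = 0" using uv(1,2) by (intro character_orthogonal phiJ neq)
        finally have "(\<Prod>e\<in>?E. W \<phi> e) = 0" using e(1) D(2) by (intro prod_zero) auto
        thus False using nz by simp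
      qed
      obtain v0 where v0: "v0 \<in> ?I" using ne by auto
      have const: "\<phi> v = \<phi> v0" if v: "v \<in> ?I" for v
      proof -
        have "(v0, v) \<in> (adjacency G)\<^sup>*" using G(2) D(8) v v0 by (auto simp: connected_mgraph_def)
        \<comment> \<open>The walk may bounce off a leaf, which carries no character; there the
          second clause remembers that its only neighbour has the right value.\<close>
        hence "(v \<in> ?I \<longrightarrow> \<phi> v = \<phi> v0) \<and>
            (v \<notin> ?I \<longrightarrow> (\<forall>z\<in>?I. (v, z) \<in> adjacency G \<longrightarrow> \<phi> z = \<phi> v0))"
        proof (induction rule: rtrancl_induct)
          case base
          thus ?case using v0 by simp
        next
          case (step y z)
          obtain e where e: "e \<in> ?E" "ends G e = {#y, z#}" using step.hyps(2) by (auto simp: adjacency_def)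
          have nodes: "y \<in> nodes G" "z \<in> nodes G" using D(5)[OF e(1)] e(2) by auto
          consider "y \<in> ?I" "z \<in> ?I" | "y \<in> ?I" "z \<notin> ?I" | "y \<notin> ?I" "z \<in> ?I"
            using edge_meets_internal[OF G ne e] by blast
          thus ?case
          proof cases
            case 1
            thus ?thesis using step.IH adj[OF 1 step.hyps(2)] by simp
          next
            case 2
            have "degree_mg G z = 1" using D(6) nodes 2 by blast
            hence "x = y" if "(z, x) \<in> adjacency G" for x
              using leaf_neighbour_unique[OF D(2) _ that adjacency_sym[OF step.hyps(2)]] by simp
            thus ?thesis using step.IH 2 by auto
          next
            case 3
            thus ?thesis using step.IH step.hyps(2) by auto
          qed
        qed
        thus ?thesis using v by blast
      qed
      have "\<phi> = (\<lambda>v\<in>?I. \<phi> v0)"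
        using phi const by (intro extensionalityI[of _ ?I]) (auto simp: PiE_def)
      moreover have "\<phi> v0 \<in> ?J" using phiJ v0 by blast
      ultimately show False using phi by blast
    qed
  qed
  also have "\<dots> = (\<Sum>j\<in>?J. (\<Prod>e\<in>?E. W (\<lambda>v\<in>?I. j) e) / (\<Prod>v\<in>?I. character_norm t ((\<lambda>v\<in>?I. j) v)))"
  proof (rule sum.reindex_cong[OF _ refl refl])
    obtain v0 where v0: "v0 \<in> ?I" using ne by auto
    show "inj_on (\<lambda>j. \<lambda>v\<in>?I. j) ?J"
    proof (rule inj_onI)
      fix i j assume "(\<lambda>v\<in>?I. i) = (\<lambda>v\<in>?I. j)"
      from fun_cong[OF this, of v0] show "i = j" using v0 by simp
    qed
  qed
  also have "\<dots> = (\<Sum>j\<in>?J. character_norm t j ^ card (inner_edges G) * leaf_sum t j ^ card (pendant_edges G) / character_norm t j ^ card ?I)"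
  proof (intro sum.cong refl)
    fix j
    have W: "W (\<lambda>v\<in>?I. j) e = (if e \<in> inner_edges G then character_norm t j else leaf_sum t j)" if e: "e \<in> ?E" for e
    proof -
      obtain u v where uv: "ends G e = {#u, v#}" using ends_pairE[OF G(1) e] by metis
      have "u \<in> ?I \<or> v \<in> ?I" by (rule edge_meets_internal[OF G ne e uv])
      moreover have "e \<in> inner_edges G \<longleftrightarrow> u \<in> ?I \<and> v \<in> ?I" using e uv by (auto simp: inner_edges_def)
      ultimately show ?thesis
        unfolding W_def cnt_def uv character_norm_def leaf_sum_def prod_power_count_pair[OF D(3)]
        by (auto simp: power2_eq_square)
    qed
    have sub: "inner_edges G \<subseteq> ?E" by (auto simp: inner_edges_def)
    have "(\<Prod>e\<in>?E. W (\<lambda>v\<in>?I. j) e) = (\<Prod>e\<in>pendant_edges G. W (\<lambda>v\<in>?I. j) e) * (\<Prod>e\<in>inner_edges G. W (\<lambda>v\<in>?I. j) e)"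
      unfolding pendant_edges_def by (rule prod.subset_diff[OF sub D(2)])
    also have "(\<Prod>e\<in>pendant_edges G. W (\<lambda>v\<in>?I. j) e) = leaf_sum t j ^ card (pendant_edges G)"
      using W by (simp add: pendant_edges_def)
    also have "(\<Prod>e\<in>inner_edges G. W (\<lambda>v\<in>?I. j) e) = character_norm t j ^ card (inner_edges G)"
    proof -
      have "(\<Prod>e\<in>inner_edges G. W (\<lambda>v\<in>?I. j) e) = (\<Prod>e\<in>inner_edges G. character_norm t j)"
        using W sub by (intro prod.cong) auto
      thus ?thesis by simp
    qed
    finally have prod_W: "(\<Prod>e\<in>?E. W (\<lambda>v\<in>?I. j) e) =
        leaf_sum t j ^ card (pendant_edges G) * character_norm t j ^ card (inner_edges G)" .
    show "(\<Prod>e\<in>?E. W (\<lambda>v\<in>?I. j) e) / (\<Prod>v\<in>?I. character_norm t ((\<lambda>v\<in>?I. j) v)) =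
        character_norm t j ^ card (inner_edges G) * leaf_sum t j ^ card (pendant_edges G) / character_norm t j ^ card ?I"
      unfolding prod_W by (simp add: mult.commute)
  qed
  finally show ?thesis .
qed

section \<open>Counting nodes and edges\<close>

lemma rtrancl_crossing:
  assumes "(u, v) \<in> r\<^sup>*" "u \<in> S" "v \<notin> S"
  shows "\<exists>x y. (x, y) \<in> r \<and> x \<in> S \<and> y \<notin> S"
  using assms by (induction rule: rtrancl_induct) blast+

text \<open>Growing \<open>S\<close> along an edge that leaves it adds one node and one edge outside
  \<open>F\<close>. Starting from a single node this bounds the nodes by the edges plus one,
  starting from a cycle by the edges.\<close>

lemma card_nodes_le_extend:
  assumes fin: "finite_mgraph G" and con: "connected_mgraph G"
    and "S \<subseteq> nodes G" "S \<noteq> {}" "F \<subseteq> edges G" "\<And>e. e \<in> F \<Longrightarrow> set_mset (ends G e) \<subseteq> S"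
  shows "card (nodes G) + card F \<le> card (edges G) + card S"
  using assms(3-)
proof (induction "card (nodes G - S)" arbitrary: S F)
  case 0
  have fN: "finite (nodes G)" and fE: "finite (edges G)" using fin by (auto simp: finite_mgraph_def)
  have "S = nodes G" using 0 fN by auto
  moreover have "card F \<le> card (edges G)" using 0 fE by (intro card_mono) auto
  ultimately show ?case by simp
next
  case (Suc n)
  have fN: "finite (nodes G)" and fE: "finite (edges G)" using fin by (auto simp: finite_mgraph_def)
  have fS: "finite S" "finite F"
    using finite_subset[OF Suc.prems(1) fN] finite_subset[OF Suc.prems(3) fE] by auto
  have "nodes G - S \<noteq> {}" using Suc.hyps(2) by (metis card.empty nat.distinct(1))
  then obtain v where v: "v \<in> nodes G" "v \<notin> S" by auto
  obtain u where u: "u \<in> S" using Suc.prems by auto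
  have "(u, v) \<in> (adjacency G)\<^sup>*" using con u v Suc.prems(1) by (auto simp: connected_mgraph_def)
  then obtain x y where xy: "(x, y) \<in> adjacency G" "x \<in> S" "y \<notin> S"
    using rtrancl_crossing[OF _ u v(2)] by metis
  then obtain e where e: "e \<in> edges G" "ends G e = {#x, y#}" by (auto simp: adjacency_def)
  have y: "y \<in> nodes G" using fin e by (auto simp: finite_mgraph_def)
  have "e \<notin> F" using Suc.prems(4)[of e] e xy by auto
  have "nodes G - S = insert y (nodes G - insert y S)" using y xy by auto
  hence "card (nodes G - S) = Suc (card (nodes G - insert y S))" using fN by (metis card_insert_disjoint Diff_iff finite_Diff insertI1)
  hence "n = card (nodes G - insert y S)" using Suc.hyps(2) by simp
  hence "card (nodes G) + card (insert e F) \<le> card (edges G) + card (insert y S)"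
  proof (rule Suc.hyps(1))
    fix f assume "f \<in> insert e F"
    thus "set_mset (ends G f) \<subseteq> insert y S" using Suc.prems(4)[of f] e xy(2) by (cases "f = e") auto
  qed (use Suc.prems(1,3) y e(1) in auto)
  thus ?case using \<open>e \<notin> F\<close> xy fS by simp
qed

lemma is_cycle_imp_card_le:
  assumes "finite_mgraph G" "connected_mgraph G" "is_cycle G vs es"
  shows "card (nodes G) \<le> card (edges G)"
proof -
  have len: "length es = length vs" and ne: "vs \<noteq> []" and d: "distinct vs" "distinct es"
    and sub: "set es \<subseteq> edges G"
    and ends: "\<And>i. i < length vs \<Longrightarrow> ends G (es ! i) = {#vs ! i, vs ! (Suc i mod length vs)#}"
    using assms(3) by (auto simp: is_cycle_def)
  have e: "set_mset (ends G e) \<subseteq> set vs" if "e \<in> set es" for e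
  proof -
    obtain i where i: "i < length vs" "e = es ! i" using \<open>e \<in> set es\<close> len by (metis in_set_conv_nth)
    have "Suc i mod length vs < length vs" using i by (intro mod_less_divisor) auto
    thus ?thesis using i ends[OF i(1)] by auto
  qed
  have "set vs \<subseteq> nodes G"
  proof
    fix v assume "v \<in> set vs"
    then obtain i where i: "i < length vs" "v = vs ! i" by (metis in_set_conv_nth)
    have "es ! i \<in> edges G" using i len sub by auto
    thus "v \<in> nodes G" using ends[OF i(1)] assms(1) i by (auto simp: finite_mgraph_def)
  qed
  from card_nodes_le_extend[OF assms(1,2) this _ sub e] ne
  have "card (nodes G) + card (set es) \<le> card (edges G) + card (set vs)" by auto
  thus ?thesis using d len by (simp add: distinct_card)
qed

definition is_path :: "('v, 'e) mgraph \<Rightarrow> 'v list \<Rightarrow> 'e list \<Rightarrow> bool" where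
  "is_path G vs es \<longleftrightarrow> length vs = Suc (length es) \<and> distinct vs \<and> set vs \<subseteq> nodes G \<and>
     set es \<subseteq> edges G \<and> (\<forall>i<length es. ends G (es ! i) = {#vs ! i, vs ! Suc i#})"

text \<open>If there is no loop at the first node of a longest path, that node has a second edge,
  whose other end must lie on the path and closes a cycle.\<close>

lemma ex_cycle_if_min_degree_2:
  assumes fin: "finite_mgraph G" and ne: "nodes G \<noteq> {}"
    and deg: "\<And>v. v \<in> nodes G \<Longrightarrow> degree_mg G v \<ge> 2"
  shows "\<exists>vs es. is_cycle G vs es"
proof -
  have fN: "finite (nodes G)" and fE: "finite (edges G)" using fin by (auto simp: finite_mgraph_def)
  obtain v where v: "v \<in> nodes G" using ne by auto
  have "is_path G [v] []" using v by (simp add: is_path_def)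
  moreover have "length vs \<le> card (nodes G)" if "is_path G vs es" for vs es
    using that fN by (metis is_path_def card_mono distinct_card)
  ultimately have "\<exists>p. is_path G (fst p) (snd p) \<and>
      (\<forall>q. is_path G (fst q) (snd q) \<longrightarrow> length (fst q) \<le> length (fst p))"
    by (intro ex_has_greatest_nat[of _ "([v], [])" _ "Suc (card (nodes G))"]) (auto simp: less_Suc_eq_le)
  then obtain vs es where path: "is_path G vs es"
    and mx: "\<And>ws fs. is_path G ws fs \<Longrightarrow> length ws \<le> length vs"
    by auto
  have len: "length vs = Suc (length es)" and dv: "distinct vs" and subv: "set vs \<subseteq> nodes G"
    and sube: "set es \<subseteq> edges G"
    and ends: "\<And>i. i < length es \<Longrightarrow> ends G (es ! i) = {#vs ! i, vs ! Suc i#}"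
    using path by (auto simp: is_path_def)
  define x where "x = vs ! 0"
  have x: "x \<in> nodes G" using len subv by (auto simp: x_def)
  show ?thesis
  proof (cases "\<exists>e\<in>edges G. ends G e = {#x, x#}")
    case True
    then obtain e where "e \<in> edges G" "ends G e = {#x, x#}" by auto
    hence "is_cycle G [x] [e]" by (simp add: is_cycle_def)
    thus ?thesis by blast
  next
    case False
    have cnt: "count (ends G e) x \<le> 1" if e: "e \<in> edges G" for e
    proof (rule ccontr)
      assume "\<not> ?thesis"
      hence c: "count (ends G e) x \<ge> 2" by simp
      have "size (ends G e) = 2" using fin e by (auto simp: finite_mgraph_def)
      moreover have "replicate_mset 2 x \<subseteq># ends G e" using c by (simp add: count_le_replicate_mset_subset_eq)
      ultimately have "ends G e = replicate_mset 2 x"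
        by (metis mset_subset_size size_replicate_mset subset_mset.le_imp_less_or_eq less_irrefl)
      thus False using False e by (auto simp: numeral_2_eq_2)
    qed
    let ?X = "{e \<in> edges G. x \<in># ends G e}"
    have "2 \<le> degree_mg G x" by (rule deg[OF x])
    also have "degree_mg G x = (\<Sum>e\<in>?X. count (ends G e) x)"
      unfolding degree_mg_def using fE by (intro sum.mono_neutral_right) (auto simp: count_eq_zero_iff)
    also have "\<dots> \<le> (\<Sum>e\<in>?X. 1)" by (intro sum_mono) (use cnt in auto)
    finally have card2: "card ?X \<ge> 2" by simp
    \<comment> \<open>If the path has no edge, \<open>es ! 0\<close> is an unspecified value; an
      edge different from it exists all the same, and extending the path then contradicts
      maximality.\<close>
    have "\<not> ?X \<subseteq> {es ! 0}"
    proof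
      assume "?X \<subseteq> {es ! 0}"
      from card_mono[OF _ this] card2 show False by simp
    qed
    then obtain e where e: "e \<in> edges G" "x \<in># ends G e" "e \<noteq> es ! 0" by auto
    have "size (ends G e) = 2" using fin e by (auto simp: finite_mgraph_def)
    with e(2) obtain u where u: "ends G e = {#x, u#}"
      by (metis insert_DiffM size_Suc_Diff1 One_nat_def Suc_1 nat.inject size_1_singleton_mset)
    have un: "u \<in> nodes G" using fin e(1) u by (auto simp: finite_mgraph_def)
    have "u \<noteq> x" using u False e(1) by auto
    have "u \<in> set vs"
    proof (rule ccontr)
      assume nu: "u \<notin> set vs"
      have "is_path G (u # vs) (e # es)"
        unfolding is_path_def
      proof (intro conjI allI impI)
        fix i assume "i < length (e # es)"
        thus "ends G ((e # es) ! i) = {#(u # vs) ! i, (u # vs) ! Suc i#}"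
          using u ends by (cases i) (auto simp: x_def add_mset_commute)
      qed (use len dv subv sube nu un e in auto)
      from mx[OF this] show False by simp
    qed
    then obtain i where i: "i < length vs" "u = vs ! i" by (metis in_set_conv_nth)
    have i0: "i > 0" using i \<open>u \<noteq> x\<close> by (cases i) (auto simp: x_def)
    have nth_eq: "k = l" if "vs ! k = vs ! l" "k < length vs" "l < length vs" for k l
      using that dv nth_eq_iff_index_eq by blast
    have e_notin: "e \<notin> set (take i es)"
    proof
      assume "e \<in> set (take i es)"
      then obtain k where k: "k < length es" "e = es ! k" by (auto simp: in_set_conv_nth)
      have "x = vs ! k \<or> x = vs ! Suc k" using ends[OF k(1)] k(2) e(2) by auto
      hence "k = 0" using nth_eq[of 0 k] nth_eq[of 0 "Suc k"] k(1) len by (auto simp: x_def)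
      thus False using k e(3) by simp
    qed
    \<comment> \<open>Distinct nodes force distinct edges: a pair of consecutive nodes determines
      its position on the path.\<close>
    have "distinct es"
    proof (unfold distinct_conv_nth, intro allI impI)
      fix k l assume kl: "k < length es" "l < length es" "k \<noteq> l"
      show "es ! k \<noteq> es ! l"
      proof
        assume "es ! k = es ! l"
        hence eq: "{#vs ! k, vs ! Suc k#} = {#vs ! l, vs ! Suc l#}" using ends kl by metis
        have "vs ! k \<in># {#vs ! l, vs ! Suc l#}" unfolding eq[symmetric] by simp
        moreover have "vs ! l \<in># {#vs ! k, vs ! Suc k#}" unfolding eq by simp
        ultimately show False using nth_eq[of k l] nth_eq[of k "Suc l"] nth_eq[of l "Suc k"] kl len by auto
      qed
    qed
    have "is_cycle G (take (Suc i) vs) (take i es @ [e])"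
      unfolding is_cycle_def
    proof (intro conjI allI impI)
      show "length (take i es @ [e]) = length (take (Suc i) vs)" using i len by simp
      show "distinct (take i es @ [e])" using e_notin \<open>distinct es\<close> by simp
      show "distinct (take (Suc i) vs)" using dv by simp
      show "set (take i es @ [e]) \<subseteq> edges G" using sube e(1) by (auto dest: in_set_takeD)
      show "take (Suc i) vs \<noteq> []" using i by auto
      fix l assume "l < length (take (Suc i) vs)"
      hence l: "l \<le> i" using i by simp
      have L: "length (take (Suc i) vs) = Suc i" using i by simp
      show "ends G ((take i es @ [e]) ! l) =
          {#take (Suc i) vs ! l, take (Suc i) vs ! (Suc l mod length (take (Suc i) vs))#}"
      proof (cases "l = i")
        case True
        thus ?thesis using L i u len by (simp add: nth_append x_def add_mset_commute)
      next
        case False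
        hence "l < i" using l by simp
        thus ?thesis using L i ends[of l] len by (simp add: nth_append)
      qed
    qed
    thus ?thesis by blast
  qed
qed

text \<open>Deleting a node of degree at most 1 removes at most one edge, so the inequality survives
  until all degrees are at least 2.\<close>

lemma ex_cycle_if_card_le:
  assumes "finite_mgraph G" "nodes G \<noteq> {}" "card (nodes G) \<le> card (edges G)"
  shows "\<exists>vs es. is_cycle G vs es"
  using assms
proof (induction "card (nodes G)" arbitrary: G rule: less_induct)
  case less
  note fin = less.prems(1)
  have fN: "finite (nodes G)" and fE: "finite (edges G)" using fin by (auto simp: finite_mgraph_def)
  show ?case
  proof (cases "\<forall>v\<in>nodes G. degree_mg G v \<ge> 2")
    case True
    thus ?thesis using ex_cycle_if_min_degree_2[OF less.prems(1,2)] by blast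
  next
    case False
    then obtain v where v: "v \<in> nodes G" "degree_mg G v < 2" by auto
    define G' where "G' = G\<lparr>nodes := nodes G - {v}, edges := {e \<in> edges G. v \<notin># ends G e}\<rparr>"
    have G': "nodes G' = nodes G - {v}" "edges G' = {e \<in> edges G. v \<notin># ends G e}" "ends G' = ends G"
      by (simp_all add: G'_def)
    let ?X = "{e \<in> edges G. v \<in># ends G e}"
    have "card ?X = (\<Sum>e\<in>?X. 1)" by simp
    also have "\<dots> \<le> (\<Sum>e\<in>?X. count (ends G e) v)" by (intro sum_mono) (auto simp: Suc_le_eq)
    also have "\<dots> \<le> degree_mg G v" unfolding degree_mg_def using fE by (intro sum_mono2) auto
    finally have "card ?X \<le> 1" using v by simp
    moreover have "card (edges G) = card ?X + card (edges G')"
      unfolding G' using fE by (subst card_Un_disjoint[symmetric]) (auto intro!: arg_cong[of _ _ card])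
    moreover have "card (nodes G) = Suc (card (nodes G'))" unfolding G' using v fN by (metis card.remove)
    ultimately have le: "card (nodes G') \<le> card (edges G')" using less.prems(3) by simp
    \<comment> \<open>A sole node would carry an edge by the inequality, necessarily a loop, and so
      have degree at least 2.\<close>
    have "nodes G' \<noteq> {}"
    proof
      assume "nodes G' = {}"
      hence N: "nodes G = {v}" using v by (auto simp: G')
      have "count (ends G e) v = 2" if e: "e \<in> edges G" for e
      proof -
        have "set_mset (ends G e) \<subseteq> {v}" "size (ends G e) = 2"
          using fin e N by (auto simp: finite_mgraph_def)
        thus ?thesis by (metis set_mset_subset_singletonD count_replicate_mset size_replicate_mset)
      qed
      hence "degree_mg G v = 2 * card (edges G)" by (simp add: degree_mg_def)
      thus False using v less.prems(3) N by simp
    qed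
    moreover have "finite_mgraph G'" using fin unfolding finite_mgraph_def G' by auto
    moreover have "card (nodes G') < card (nodes G)" using \<open>card (nodes G) = Suc _\<close> by simp
    ultimately obtain vs es where "is_cycle G' vs es" using less.hyps le by blast
    hence "is_cycle G vs es" by (auto simp: is_cycle_def G')
    thus ?thesis by blast
  qed
qed

lemma sum_count_pair:
  assumes "finite A"
  shows "(\<Sum>x\<in>A. count {#u, v#} x) = of_bool (u \<in> A) + of_bool (v \<in> A)"
proof -
  have "(\<Sum>x\<in>A. count {#u, v#} x) = (\<Sum>x\<in>A. (if x = u then 1 else 0) + (if x = v then 1 else 0))"
    by (intro sum.cong refl) auto
  also have "\<dots> = of_bool (u \<in> A) + of_bool (v \<in> A)"
    using assms by (simp add: sum.distrib sum.delta)
  finally show ?thesis .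
qed

context
  fixes G :: "('v, 'e) mgraph"
  assumes G: "one_three_graph G" "connected_mgraph G" and ne: "internal_nodes G \<noteq> {}"
begin

lemma edges_split:
  "edges G = inner_edges G \<union> pendant_edges G" "inner_edges G \<inter> pendant_edges G = {}"
  "finite (inner_edges G)" "finite (pendant_edges G)"
  using one_three_graphD(2)[OF G(1)] by (auto simp: pendant_edges_def inner_edges_def)

lemma edge_end_counts:
  assumes e: "e \<in> edges G"
  shows "(\<Sum>v\<in>internal_nodes G. count (ends G e) v) = (if e \<in> inner_edges G then 2 else 1)"
    and "(\<Sum>v\<in>nodes G - internal_nodes G. count (ends G e) v) = (if e \<in> inner_edges G then 0 else 1)"
proof -
  note D = one_three_graphD[OF G(1)]
  obtain u v where uv: "ends G e = {#u, v#}" "u \<in> nodes G" "v \<in> nodes G"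
    using ends_pairE[OF G(1) e] by metis
  have "u \<in> internal_nodes G \<or> v \<in> internal_nodes G" by (rule edge_meets_internal[OF G ne e uv(1)])
  moreover have "e \<in> inner_edges G \<longleftrightarrow> u \<in> internal_nodes G \<and> v \<in> internal_nodes G"
    using e uv by (auto simp: inner_edges_def)
  moreover have "(\<Sum>v\<in>internal_nodes G. count (ends G e) v) =
      of_bool (u \<in> internal_nodes G) + of_bool (v \<in> internal_nodes G)"
    unfolding uv(1) by (rule sum_count_pair[OF D(3)])
  moreover have "(\<Sum>v\<in>nodes G - internal_nodes G. count (ends G e) v) =
      of_bool (u \<in> nodes G - internal_nodes G) + of_bool (v \<in> nodes G - internal_nodes G)"
    unfolding uv(1) using D(1) by (intro sum_count_pair) auto
  ultimately show "(\<Sum>v\<in>internal_nodes G. count (ends G e) v) = (if e \<in> inner_edges G then 2 else 1)"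
    and "(\<Sum>v\<in>nodes G - internal_nodes G. count (ends G e) v) = (if e \<in> inner_edges G then 0 else 1)"
    using uv(2,3) by auto
qed

lemma sum_edges_if:
  "(\<Sum>e\<in>edges G. if e \<in> inner_edges G then a else b :: nat) =
    a * card (inner_edges G) + b * card (pendant_edges G)"
proof -
  have "(\<Sum>e\<in>pendant_edges G. if e \<in> inner_edges G then a else b) = (\<Sum>e\<in>pendant_edges G. b)"
    by (intro sum.cong) (auto simp: pendant_edges_def)
  thus ?thesis unfolding edges_split(1) using edges_split(2-4) by (subst sum.union_disjoint) auto
qed

lemma handshake_internal: "3 * card (internal_nodes G) = 2 * card (inner_edges G) + card (pendant_edges G)"
proof -
  have "3 * card (internal_nodes G) = (\<Sum>v\<in>internal_nodes G. degree_mg G v)"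
    using one_three_graphD(7)[OF G(1)] by simp
  also have "\<dots> = (\<Sum>e\<in>edges G. \<Sum>v\<in>internal_nodes G. count (ends G e) v)"
    unfolding degree_mg_def by (rule sum.swap)
  also have "\<dots> = (\<Sum>e\<in>edges G. if e \<in> inner_edges G then 2 else 1)"
    by (intro sum.cong refl edge_end_counts)
  finally show ?thesis by (simp add: sum_edges_if)
qed

lemma card_leaves_eq: "card (nodes G - internal_nodes G) = card (pendant_edges G)"
proof -
  have "card (nodes G - internal_nodes G) = (\<Sum>v\<in>nodes G - internal_nodes G. degree_mg G v)"
    using one_three_graphD(6)[OF G(1)] by simp
  also have "\<dots> = (\<Sum>e\<in>edges G. \<Sum>v\<in>nodes G - internal_nodes G. count (ends G e) v)"
    unfolding degree_mg_def by (rule sum.swap)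
  also have "\<dots> = (\<Sum>e\<in>edges G. if e \<in> inner_edges G then 0 else 1)"
    by (intro sum.cong refl edge_end_counts)
  finally show ?thesis by (simp add: sum_edges_if)
qed

lemma cubic_iff_no_pendant: "cubic_graph G \<longleftrightarrow> card (pendant_edges G) = 0"
proof -
  have "cubic_graph G \<longleftrightarrow> nodes G - internal_nodes G = {}"
    using G(1) by (auto simp: cubic_graph_def one_three_graph_def internal_nodes_def)
  also have "\<dots> \<longleftrightarrow> card (nodes G - internal_nodes G) = 0"
    using one_three_graphD(1)[OF G(1)] by simp
  finally show ?thesis by (simp add: card_leaves_eq)
qed

text \<open>Pendant edges and leaves are equinumerous and cancel from the comparison of nodes with
  edges. What remains is the exponent of the norm: -1 for trees, nonnegative otherwise.\<close>

lemma tree_dichotomy: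
  "(tree_mgraph G \<and> card (inner_edges G) + 1 = card (internal_nodes G)) \<or>
   (\<not> tree_mgraph G \<and> card (internal_nodes G) \<le> card (inner_edges G))"
proof -
  have fin: "finite_mgraph G" using G by (simp add: one_three_graph_def)
  have E: "card (edges G) = card (inner_edges G) + card (pendant_edges G)"
    using edges_split by (simp add: card_Un_disjoint)
  have sub: "internal_nodes G \<subseteq> nodes G" by (auto simp: internal_nodes_def)
  have "card (nodes G) = card (internal_nodes G) + card (nodes G - internal_nodes G)"
    using one_three_graphD(1,3)[OF G(1)] sub by (simp add: card_Diff_subset card_mono)
  hence N: "card (nodes G) = card (internal_nodes G) + card (pendant_edges G)"
    by (simp add: card_leaves_eq)
  have nonempty: "nodes G \<noteq> {}" using G(2) by (simp add: connected_mgraph_def)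
  then obtain v where v: "v \<in> nodes G" by auto
  have ge: "card (nodes G) \<le> card (edges G) + 1"
    using card_nodes_le_extend[OF fin G(2), of "{v}" "{}"] v by simp
  show ?thesis
  proof (cases "tree_mgraph G")
    case True
    hence "\<not> card (nodes G) \<le> card (edges G)"
      using ex_cycle_if_card_le[OF fin nonempty] by (auto simp: tree_mgraph_def)
    thus ?thesis using True ge E N by simp
  next
    case False
    then obtain vs es where "is_cycle G vs es" using fin G(2) by (auto simp: tree_mgraph_def)
    from is_cycle_imp_card_le[OF fin G(2) this] show ?thesis using False E N by simp
  qed
qed

end

text \<open>All degrees are 1, so the graph is one edge with two leaves, and the polytope is the
  interval from 0 to 1/2.\<close>

lemma no_internal_nodes:
  fixes G :: "('v, 'e) mgraph"
  assumes G: "one_three_graph G" "connected_mgraph G" and empty: "internal_nodes G = {}"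
  shows "tree_mgraph G" and "ehrhart_P G t = t div 2 + 1"
proof -
  note D = one_three_graphD[OF G(1)]
  have fin: "finite_mgraph G" using G by (simp add: one_three_graph_def)
  obtain u where u: "u \<in> nodes G" using G(2) by (auto simp: connected_mgraph_def)
  have deg: "degree_mg G v = 1" if "v \<in> nodes G" for v using D(6) that empty by auto
  have "(\<Sum>e\<in>edges G. count (ends G e) u) \<noteq> 0" using deg[OF u] by (simp add: degree_mg_def)
  then obtain e where e: "e \<in> edges G" "u \<in># ends G e"
    using D(2) by (auto simp: count_eq_zero_iff)
  obtain a b where ab: "ends G e = {#a, b#}" "a \<in> nodes G" "b \<in> nodes G"
    using ends_pairE[OF G(1) e(1)] by metis
  have "a \<noteq> b" using leaf_edge_unique(2)[OF D(2) deg[OF ab(2)] e(1) _ e(1)] ab(1) by auto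
  have adj: "(a, b) \<in> adjacency G" using e ab by (auto simp: adjacency_def)
  have reach: "x = a \<or> x = b" if "(a, x) \<in> (adjacency G)\<^sup>*" for x
    using that
  proof (induction rule: rtrancl_induct)
    case (step y z)
    thus ?case
      using leaf_neighbour_unique[OF D(2) deg[OF ab(2)] adj]
        leaf_neighbour_unique[OF D(2) deg[OF ab(3)] adjacency_sym[OF adj]]
      by auto
  qed simp
  have "f = e" if f: "f \<in> edges G" for f
  proof -
    obtain x y where xy: "ends G f = {#x, y#}" "x \<in> nodes G" using ends_pairE[OF G(1) f] by metis
    have "x = a \<or> x = b" using G(2) ab xy by (intro reach) (auto simp: connected_mgraph_def)
    thus ?thesis using leaf_edge_unique(1)[OF D(2) deg[OF xy(2)] f _ e(1)] xy ab by auto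
  qed
  hence E: "edges G = {e}" using e(1) by blast
  have "card {a, b} \<le> card (nodes G)" using ab D(1) by (intro card_mono) auto
  hence "\<not> card (nodes G) \<le> card (edges G)" using \<open>a \<noteq> b\<close> by (simp add: E)
  thus "tree_mgraph G" using is_cycle_imp_card_le[OF fin G(2)] fin G(2) by (auto simp: tree_mgraph_def)
  have "component_of G u = nodes G" using G(2) u by (auto simp: component_of_def connected_mgraph_def)
  hence "{f \<in> edges G. set_mset (ends G f) \<subseteq> component_of G u} = {e}" using E D(5) by auto
  hence comp: "is_component_edge G e" using u by (auto simp: is_component_edge_def)
  have P: "polytope_P G = {w \<in> {e} \<rightarrow>\<^sub>E UNIV. 0 \<le> w e \<and> w e \<le> 1 / 2}"
    unfolding polytope_P_def E empty using comp by auto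
  define \<iota> where "\<iota> = (\<lambda>k::nat. \<lambda>f\<in>{e}. real k)"
  have "dilate {e} (real t) (polytope_P G) \<inter> ({e} \<rightarrow>\<^sub>E \<int>) = \<iota> ` {..t div 2}"
  proof (intro equalityI subsetI)
    fix w assume "w \<in> dilate {e} (real t) (polytope_P G) \<inter> ({e} \<rightarrow>\<^sub>E \<int>)"
    then obtain p where p: "0 \<le> p e" "p e \<le> 1 / 2" "w = (\<lambda>f\<in>{e}. real t * p f)" and "w e \<in> \<int>"
      by (auto simp: dilate_def P PiE_def Pi_def)
    then obtain k :: int where k: "real t * p e = of_int k" by (auto elim: Ints_cases)
    have "0 \<le> real t * p e" "real t * p e \<le> real t * (1 / 2)"
      using mult_left_mono[OF p(2), of "real t"] p(1) by simp_all
    hence "0 \<le> k" "2 * k \<le> int t" unfolding k by linarith+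
    hence "nat k \<le> t div 2" "w = \<iota> (nat k)" using k p(3) by (auto simp: \<iota>_def fun_eq_iff)
    thus "w \<in> \<iota> ` {..t div 2}" by blast
  next
    fix w assume "w \<in> \<iota> ` {..t div 2}"
    then obtain k where k: "k \<le> t div 2" "w = \<iota> k" by auto
    have "2 * k \<le> t" using k by simp
    hence "real k / real t \<le> 1 / 2" by (cases "t = 0") (auto simp: field_simps)
    hence "(\<lambda>f\<in>{e}. real k / real t) \<in> polytope_P G" by (auto simp: P)
    moreover have "w = (\<lambda>f\<in>{e}. real t * ((\<lambda>f\<in>{e}. real k / real t) f))"
      using \<open>2 * k \<le> t\<close> by (auto simp: k \<iota>_def fun_eq_iff)
    ultimately have "w \<in> dilate {e} (real t) (polytope_P G)"
      unfolding dilate_def by (intro image_eqI[of w _ "\<lambda>f\<in>{e}. real k / real t"])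
    moreover have "w \<in> {e} \<rightarrow>\<^sub>E \<int>" by (auto simp: k \<iota>_def)
    ultimately show "w \<in> dilate {e} (real t) (polytope_P G) \<inter> ({e} \<rightarrow>\<^sub>E \<int>)" by blast
  qed
  moreover have "inj_on \<iota> {..t div 2}"
  proof (rule inj_onI)
    fix k l assume "\<iota> k = \<iota> l"
    from fun_cong[OF this, of e] show "k = l" by (simp add: \<iota>_def)
  qed
  ultimately show "ehrhart_P G t = t div 2 + 1" unfolding ehrhart_P_def E by (simp add: card_image)
qed

section \<open>Evaluation of the character sums\<close>

lemma leaf_sum_eq:
  assumes j: "j \<in> {1..(t + 2) div 2}"
  shows "leaf_sum t j = (1 - cos (real (2 * (t div 2 + 1)) * half_angle t j)) / (2 * sin (half_angle t j) ^ 2)"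
proof -
  define \<alpha> where "\<alpha> = half_angle t j"
  have s: "sin \<alpha> \<noteq> 0" using sin_half_angle_neq_0[OF j] by (simp add: \<alpha>_def)
  have "2 * sin \<alpha> * (\<Sum>a\<le>t div 2. sin (real (2 * a + 1) * \<alpha>)) =
      (\<Sum>a\<in>{0..<0 + (t div 2 + 1)}. 2 * sin \<alpha> * sin (real (2 * a + 1) * \<alpha>))"
    unfolding sum_distrib_left by (intro sum.cong) auto
  also have "\<dots> = 1 - cos (real (2 * (t div 2 + 1)) * \<alpha>)"
    unfolding sum_sin_odd_multiples by simp
  finally have "(\<Sum>a\<le>t div 2. sin (real (2 * a + 1) * \<alpha>)) / sin \<alpha> =
      (1 - cos (real (2 * (t div 2 + 1)) * \<alpha>)) / (2 * sin \<alpha> ^ 2)"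
    using s by (simp add: field_simps power2_eq_square)
  thus ?thesis unfolding leaf_sum_def character_def sum_divide_distrib \<alpha>_def .
qed

text \<open>The telescoped sum ends at the angle \<open>j * \<pi>\<close>, whose cosine is the sign
  of the parity of \<open>j\<close>; hence only odd \<open>j\<close> matter once there are
  leaves.\<close>

lemma leaf_sum_even:
  assumes j: "j \<in> {1..(t + 2) div 2}" and "even t"
  shows "leaf_sum t j = (if odd j then 1 / sin (pi * real j / real (t + 2)) ^ 2 else 0)"
proof -
  have "real (2 * (t div 2 + 1)) = real (t + 2)" using assms by auto
  hence "real (2 * (t div 2 + 1)) * half_angle t j = real j * pi" using assms by (simp add: half_angle_def)
  hence "cos (real (2 * (t div 2 + 1)) * half_angle t j) = (-1) ^ j" by (simp only: cos_npi)
  thus ?thesis unfolding leaf_sum_eq[OF j] using assms by (simp add: half_angle_def)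
qed

text \<open>The end angle falls short of \<open>2 * j * \<pi>\<close> by \<open>2 * \<beta>\<close>,
  so half-angle formulas give a squared secant. Without the doubling in \<open>half_angle\<close> a
  sign depending on \<open>j\<close> would remain.\<close>

lemma leaf_sum_odd:
  assumes j: "j \<in> {1..(t + 2) div 2}" and "odd t"
  shows "leaf_sum t j = 1 / 4 * (1 / cos (pi * real j / real (t + 2)) ^ 2)"
proof -
  define \<beta> where "\<beta> = pi * real j / real (t + 2)"
  have half_angle: "half_angle t j = 2 * \<beta>" using assms by (simp add: half_angle_def \<beta>_def)
  have s: "sin (2 * \<beta>) \<noteq> 0" using sin_half_angle_neq_0[OF j] by (simp add: half_angle)
  have "real (2 * (t div 2 + 1)) = real (t + 2) - 1" using assms by (auto elim!: oddE)
  hence "real (2 * (t div 2 + 1)) * half_angle t j = 2 * real j * pi - 2 * \<beta>"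
    by (simp only: half_angle) (simp add: \<beta>_def field_simps)
  moreover have "cos (2 * real j * pi) = 1" "sin (2 * real j * pi) = 0"
    using cos_npi[of "2 * j"] sin_npi[of "2 * j"] by (simp_all add: mult_ac)
  ultimately have "cos (real (2 * (t div 2 + 1)) * half_angle t j) = cos (2 * \<beta>)"
    by (simp only: cos_diff mult_1_left mult_zero_left add_0_right)
  hence "leaf_sum t j = (1 - cos (2 * \<beta>)) / (2 * sin (2 * \<beta>) ^ 2)"
    unfolding leaf_sum_eq[OF j] by (simp only: half_angle)
  also have "1 - cos (2 * \<beta>) = 2 * sin \<beta> ^ 2" by (simp add: cos_double_sin)
  also have "2 * sin \<beta> ^ 2 / (2 * sin (2 * \<beta>) ^ 2) = 1 / 4 * (1 / cos \<beta> ^ 2)"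
    using s unfolding sin_double by (simp add: power_mult_distrib)
  finally show ?thesis unfolding \<beta>_def .
qed

lemma character_norm_even:
  assumes "j \<in> {1..<t div 2 + 1}" "even t"
  shows "character_norm t j = real (t + 2) / 4 * (1 / sin (pi * real j / real (t + 2)) ^ 2)"
  using assms character_norm_eq[of j t] by (auto simp: half_angle_def)

lemma character_norm_even_half:
  assumes "even t"
  shows "character_norm t (t div 2 + 1) = real (t + 2) / 2"
  using assms character_norm_eq[of "t div 2 + 1" t] by auto

lemma character_norm_odd:
  assumes j: "j \<in> {1..(t + 2) div 2}" and "odd t"
  shows "character_norm t j = real (t + 2) / 16 *
    ((1 / sin (pi * real j / real (t + 2)) ^ 2) * (1 / cos (pi * real j / real (t + 2)) ^ 2))"
proof -
  define \<beta> where "\<beta> = pi * real j / real (t + 2)"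
  have half_angle: "half_angle t j = 2 * \<beta>" using assms by (simp add: half_angle_def \<beta>_def)
  have "2 * j \<noteq> t + 2" using assms by presburger
  hence "character_norm t j = real (t + 2) / 4 * (1 / sin (2 * \<beta>) ^ 2)"
    using character_norm_eq[OF j] by (simp add: half_angle)
  thus ?thesis unfolding \<beta>_def[symmetric] by (simp add: sin_double power_mult_distrib)
qed

section \<open>Folding and splitting of cosecant and secant sums\<close>

lemma sum_symmetric_even:
  fixes g :: "nat \<Rightarrow> real"
  assumes "H > 0" "\<And>j. j \<in> {1..<H} \<Longrightarrow> g (2 * H - j) = g j"
  shows "(\<Sum>j\<in>{1..<2 * H}. g j) = 2 * (\<Sum>j\<in>{1..<H}. g j) + g H"
proof -
  have sym: "g (2 * H - j) = g j" if "j \<in> {H<..<2 * H}" for j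
  proof -
    have "2 * H - j \<in> {1..<H}" "2 * H - (2 * H - j) = j" using that by auto
    thus ?thesis using assms(2)[of "2 * H - j"] by simp
  qed
  have "{1..<2 * H} = {1..<H} \<union> insert H {H<..<2 * H}" using assms(1) by auto
  hence "(\<Sum>j\<in>{1..<2 * H}. g j) = (\<Sum>j\<in>{1..<H}. g j) + g H + (\<Sum>j\<in>{H<..<2 * H}. g j)"
    by (simp only:) (subst sum.union_disjoint, auto)
  also have "(\<Sum>j\<in>{H<..<2 * H}. g j) = (\<Sum>j\<in>{1..<H}. g j)"
    by (rule sum.reindex_bij_witness[of _ "\<lambda>j. 2 * H - j" "\<lambda>j. 2 * H - j"])
       (auto simp: sym)
  finally show ?thesis by simp
qed

lemma sum_symmetric_odd:
  fixes g :: "nat \<Rightarrow> real"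
  assumes "\<And>j. j \<in> {1..H} \<Longrightarrow> g (2 * H + 1 - j) = g j"
  shows "(\<Sum>j\<in>{1..<2 * H + 1}. g j) = 2 * (\<Sum>j\<in>{1..H}. g j)"
proof -
  have sym: "g (2 * H + 1 - j) = g j" if "j \<in> {H<..<2 * H + 1}" for j
  proof -
    have "2 * H + 1 - j \<in> {1..H}" "2 * H + 1 - (2 * H + 1 - j) = j" using that by auto
    thus ?thesis using assms[of "2 * H + 1 - j"] by simp
  qed
  have "{1..<2 * H + 1} = {1..H} \<union> {H<..<2 * H + 1}" by auto
  hence "(\<Sum>j\<in>{1..<2 * H + 1}. g j) = (\<Sum>j\<in>{1..H}. g j) + (\<Sum>j\<in>{H<..<2 * H + 1}. g j)"
    by (simp only:) (subst sum.union_disjoint, auto)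
  also have "(\<Sum>j\<in>{H<..<2 * H + 1}. g j) = (\<Sum>j\<in>{1..H}. g j)"
    by (rule sum.reindex_bij_witness[of _ "\<lambda>j. 2 * H + 1 - j" "\<lambda>j. 2 * H + 1 - j"])
       (use sym in auto)
  finally show ?thesis by simp
qed

text \<open>For even \<open>t\<close> and \<open>M = t div 2 + 1\<close> the angles are those where
  \<open>leaf_sum\<close> is nonzero, together with their reflections. For odd \<open>M\<close> the
  same sums are secant sums in disguise.\<close>

definition odd_csc_sum :: "nat \<Rightarrow> nat \<Rightarrow> real" where
  "odd_csc_sum p M = (\<Sum>k<M. (1 / sin (pi * real (2 * k + 1) / real (2 * M)) ^ 2) ^ p)"

lemma sum_split_parity:
  fixes g :: "nat \<Rightarrow> real"
  shows "(\<Sum>j\<in>{1..<2 * Suc M}. g j) = (\<Sum>k<Suc M. g (2 * k + 1)) + (\<Sum>k\<in>{1..<Suc M}. g (2 * k))"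
  by (induction M) (simp_all add: numeral_2_eq_2)

lemma odd_csc_sum_eq:
  assumes "M > 0"
  shows "odd_csc_sum p M = csc_sum p (2 * M) - csc_sum p M"
proof -
  obtain M' where M': "M = Suc M'" using assms by (cases M) auto
  have "csc_sum p (2 * M) = odd_csc_sum p M +
      (\<Sum>k\<in>{1..<M}. (1 / sin (pi * real (2 * k) / real (2 * M)) ^ 2) ^ p)"
    unfolding csc_sum_def odd_csc_sum_def M' by (rule sum_split_parity)
  also have "(\<Sum>k\<in>{1..<M}. (1 / sin (pi * real (2 * k) / real (2 * M)) ^ 2) ^ p) = csc_sum p M"
    unfolding csc_sum_def by (intro sum.cong refl) simp
  finally show ?thesis by simp
qed

text \<open>The difference of the polynomial at \<open>2 * M\<close> and at \<open>M\<close> has no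
  constant term, hence is divisible by \<open>M\<close>. For trees this absorbs the norm in the
  denominator.\<close>

lemma poly_fun_on_odd_csc_sum_div: "poly_fun_on {0<..} (\<lambda>M. odd_csc_sum p M / real M)"
proof -
  obtain P where P: "\<And>N. N > 0 \<Longrightarrow> csc_sum p N = poly P (real N)"
    using poly_fun_on_csc_sum[of p] by (auto simp: poly_fun_on_def)
  define Q where "Q = P \<circ>\<^sub>p [:0, 2:] - P"
  have "poly Q 0 = 0" by (simp add: Q_def poly_pcompose)
  then obtain R where R: "Q = [:0, 1:] * R" by (metis poly_eq_0_iff_dvd dvdE minus_zero)
  have "odd_csc_sum p M / real M = poly R (real M)" if "M > 0" for M
  proof -
    have "odd_csc_sum p M = poly Q (real M)"
      using that by (simp add: odd_csc_sum_eq P Q_def poly_pcompose mult_ac)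
    also have "\<dots> = real M * poly R (real M)" by (simp add: R)
    finally show ?thesis using that by simp
  qed
  thus ?thesis by (auto simp: poly_fun_on_def)
qed

lemma poly_fun_on_odd_csc_sum: "poly_fun_on {0<..} (odd_csc_sum p)"
proof -
  have "poly_fun_on {0<..} (\<lambda>M. real M * (odd_csc_sum p M / real M))"
    by (intro poly_fun_on_mult poly_fun_on_of_nat poly_fun_on_odd_csc_sum_div)
  thus ?thesis by (subst poly_fun_on_cong) auto
qed

definition csc_sec_sum :: "nat \<Rightarrow> nat \<Rightarrow> nat \<Rightarrow> real" where
  "csc_sec_sum q p N = (\<Sum>j\<in>{1..<N}. (1 / sin (pi * real j / real N) ^ 2) ^ q * (1 / cos (pi * real j / real N) ^ 2) ^ p)"

lemma sum_periodic_shift: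
  fixes F :: "nat \<Rightarrow> real"
  assumes "\<And>k. F (k + N) = F k"
  shows "(\<Sum>l<N. F (l + m)) = (\<Sum>l<N. F l)"
proof (induction m)
  case (Suc m)
  have "(\<Sum>l<N. F (l + Suc m)) + F m = (\<Sum>l<Suc N. F (l + m))"
    by (subst sum.lessThan_Suc_shift) simp
  also have "\<dots> = (\<Sum>l<N. F (l + m)) + F m"
    using assms[of m] by (simp add: add.commute)
  finally show ?case using Suc by simp
qed simp

text \<open>The subtracted 1 is the term \<open>j = 0\<close>.\<close>

lemma csc_sec_sum_0:
  assumes "odd N"
  shows "csc_sec_sum 0 p N = odd_csc_sum p N - 1"
proof -
  define F where "F = (\<lambda>k. (1 / sin (pi * real (2 * k + 1) / real (2 * N)) ^ 2) ^ p)"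
  have N: "N > 0" using assms by (cases N) auto
  have per: "F (k + N) = F k" for k
  proof -
    have "pi * real (2 * (k + N) + 1) / real (2 * N) = pi * real (2 * k + 1) / real (2 * N) + pi"
      using N by (simp add: field_simps)
    thus ?thesis unfolding F_def by (simp only: sin_periodic_pi) simp
  qed
  \<comment> \<open>For odd \<open>N\<close> the shift by \<open>N div 2\<close> moves the angle to
    \<open>\<pi> l / N + \<pi> / 2\<close>, where sine becomes cosine.\<close>
  have F: "F (l + N div 2) = (1 / cos (pi * real l / real N) ^ 2) ^ p" for l
  proof -
    have "2 * (l + N div 2) + 1 = 2 * l + N" using assms by presburger
    hence "pi * real (2 * (l + N div 2) + 1) / real (2 * N) = pi * real (2 * l + N) / real (2 * N)"
      by (simp only:)
    also have "\<dots> = pi * real l / real N + pi / 2" using N by (simp add: field_simps)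
    finally show ?thesis unfolding F_def by (simp only: sin_add) simp
  qed
  have "odd_csc_sum p N = (\<Sum>l<N. F (l + N div 2))"
    unfolding sum_periodic_shift[of F, OF per] by (simp add: odd_csc_sum_def F_def)
  also have "\<dots> = (\<Sum>l<N. (1 / cos (pi * real l / real N) ^ 2) ^ p)" by (simp only: F)
  also have "{..<N} = insert 0 {1..<N}" using N by auto
  finally show ?thesis by (simp add: csc_sec_sum_def)
qed

lemma cos_pi_mult_div_odd_neq_0:
  assumes "odd N"
  shows "cos (pi * real j / real N) \<noteq> 0"
proof
  assume "cos (pi * real j / real N) = 0"
  then obtain i :: int where i: "odd i" "pi * real j / real N = of_int i * (pi / 2)"
    by (subst (asm) cos_zero_iff_int) auto
  have "N > 0" using assms by (cases N) auto
  hence "real_of_int (2 * int j) = real_of_int (i * int N)" using i(2) by (simp add: field_simps)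
  hence "2 * int j = i * int N" by (simp only: of_int_eq_iff)
  hence "even (i * int N)" by (metis dvd_triv_left)
  thus False using i(1) assms by simp
qed

text \<open>If \<open>s + c = 1\<close>, then \<open>1 / (s * c) = 1 / s + 1 / c\<close>. Each use
  lowers the total exponent by one, until only pure cosecant or secant sums are left.\<close>

lemma csc_sec_sum_Suc:
  assumes "odd N"
  shows "csc_sec_sum (Suc q) (Suc p) N = csc_sec_sum (Suc q) p N + csc_sec_sum q (Suc p) N"
  unfolding csc_sec_sum_def sum.distrib[symmetric]
proof (intro sum.cong refl)
  fix j assume j: "j \<in> {1..<N}"
  define s where "s = sin (pi * real j / real N) ^ 2"
  define c where "c = cos (pi * real j / real N) ^ 2"
  have sc: "s + c = 1" by (simp add: s_def c_def)
  have "s \<noteq> 0" "c \<noteq> 0"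
    using sin_pi_mult_div_neq_0[of j N] cos_pi_mult_div_odd_neq_0[OF assms, of j] j by (auto simp: s_def c_def)
  hence inv: "(1 / s) * (1 / c) = 1 / s + 1 / c" using sc by (simp add: field_simps)
  have "(1 / s) ^ Suc q * (1 / c) ^ Suc p = (1 / s) ^ q * (1 / c) ^ p * ((1 / s) * (1 / c))"
    by (simp only: power_Suc mult_ac)
  also have "\<dots> = (1 / s) ^ Suc q * (1 / c) ^ p + (1 / s) ^ q * (1 / c) ^ Suc p"
    unfolding inv by (simp only: power_Suc distrib_left mult_ac)
  finally show "(1 / s) ^ Suc q * (1 / c) ^ Suc p =
      (1 / s) ^ Suc q * (1 / c) ^ p + (1 / s) ^ q * (1 / c) ^ Suc p" .
qed

lemma poly_fun_on_csc_sec_sum: "poly_fun_on {N. odd N} (csc_sec_sum q p)"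
proof (induction "q + p" arbitrary: q p)
  case 0
  have "poly_fun_on {N. odd N} (\<lambda>N. odd_csc_sum 0 N - 1)"
    by (intro poly_fun_on_intros poly_fun_on_subset[OF poly_fun_on_odd_csc_sum]) (auto intro: gr0I)
  thus ?case using 0 by (subst poly_fun_on_cong) (auto simp: csc_sec_sum_0)
next
  case (Suc n)
  show ?case
  proof (cases "q = 0")
    case True
    have "poly_fun_on {N. odd N} (\<lambda>N. odd_csc_sum p N - 1)"
      by (intro poly_fun_on_intros poly_fun_on_subset[OF poly_fun_on_odd_csc_sum]) (auto intro: gr0I)
    thus ?thesis using True by (subst poly_fun_on_cong) (auto simp: csc_sec_sum_0)
  next
    case False
    then obtain q' where q: "q = Suc q'" by (cases q) auto
    show ?thesis
    proof (cases p)
      case 0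
      have "poly_fun_on {N. odd N} (csc_sum q)"
        by (rule poly_fun_on_subset[OF poly_fun_on_csc_sum]) (auto intro: gr0I)
      thus ?thesis by (subst poly_fun_on_cong) (auto simp: 0 csc_sec_sum_def csc_sum_def)
    next
      case (Suc p')
      have "poly_fun_on {N. odd N} (csc_sec_sum (Suc q') p')" "poly_fun_on {N. odd N} (csc_sec_sum q' (Suc p'))"
        using Suc.hyps q \<open>Suc n = q + p\<close> \<open>p = Suc p'\<close> by auto
      from poly_fun_on_add[OF this] show ?thesis unfolding q Suc
        by (subst poly_fun_on_cong) (auto simp: csc_sec_sum_Suc)
    qed
  qed
qed

lemma poly_fun_on_shift_even:
  assumes "poly_fun_on {0<..} (f :: nat \<Rightarrow> real)"
  shows "poly_fun_on {t. even t} (\<lambda>t. f (t div 2 + 1))"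
  by (rule poly_fun_on_affine[OF assms, where c = "1/2" and d = 1]) auto

lemma poly_fun_on_shift:
  assumes "poly_fun_on B (f :: nat \<Rightarrow> real)" "\<And>t. t \<in> A \<Longrightarrow> t + 2 \<in> B"
  shows "poly_fun_on A (\<lambda>t. f (t + 2))"
  by (rule poly_fun_on_affine[OF assms(1), where c = 1 and d = 2]) (use assms(2) in auto)

lemma sin_pi_reflect:
  assumes "j \<le> N" "N > 0"
  shows "sin (pi * real (N - j) / real N) = sin (pi * real j / real N)"
    and "cos (pi * real (N - j) / real N) = - cos (pi * real j / real N)"
proof -
  have "pi * real (N - j) / real N = pi - pi * real j / real N"
    using assms by (simp add: of_nat_diff field_simps)
  thus "sin (pi * real (N - j) / real N) = sin (pi * real j / real N)"
    and "cos (pi * real (N - j) / real N) = - cos (pi * real j / real N)"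
    by (simp_all only: sin_pi_minus cos_pi_minus)
qed

lemma sin_pi_half_index: "H > 0 \<Longrightarrow> sin (pi * real H / real (2 * H)) = 1"
  by simp

lemma half_csc_sum:
  assumes "H > 0"
  shows "(\<Sum>j\<in>{1..<H}. (1 / sin (pi * real j / real (2 * H)) ^ 2) ^ p) = (csc_sum p (2 * H) - 1) / 2"
proof -
  have "csc_sum p (2 * H) = 2 * (\<Sum>j\<in>{1..<H}. (1 / sin (pi * real j / real (2 * H)) ^ 2) ^ p) +
      (1 / sin (pi * real H / real (2 * H)) ^ 2) ^ p"
    unfolding csc_sum_def
  proof (rule sum_symmetric_even[OF assms])
    fix j assume "j \<in> {1..<H}"
    hence "j \<le> 2 * H" "2 * H > 0" by auto
    from sin_pi_reflect(1)[OF this]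
    show "(1 / sin (pi * real (2 * H - j) / real (2 * H)) ^ 2) ^ p = (1 / sin (pi * real j / real (2 * H)) ^ 2) ^ p"
      by (simp only:)
  qed
  thus ?thesis unfolding sin_pi_half_index[OF assms] by simp
qed

text \<open>The reflection in \<open>H\<close> keeps parity and fixes \<open>H\<close>, where the
  cosecant is 1; the middle term belongs to the sum exactly for odd \<open>H\<close>.\<close>

lemma half_odd_csc_sum:
  assumes "H > 0"
  shows "(\<Sum>j\<in>{1..<H}. if odd j then (1 / sin (pi * real j / real (2 * H)) ^ 2) ^ p else 0) =
    (odd_csc_sum p H - of_bool (odd H)) / 2"
proof -
  define g where "g = (\<lambda>j. if odd j then (1 / sin (pi * real j / real (2 * H)) ^ 2) ^ p else 0)"
  obtain H' where H': "H = Suc H'" using assms by (cases H) auto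
  have "(\<Sum>j\<in>{1..<2 * H}. g j) = (\<Sum>k<H. g (2 * k + 1)) + (\<Sum>k\<in>{1..<H}. g (2 * k))"
    unfolding H' by (rule sum_split_parity)
  also have "\<dots> = odd_csc_sum p H" unfolding odd_csc_sum_def g_def by simp
  finally have "odd_csc_sum p H = (\<Sum>j\<in>{1..<2 * H}. g j)" ..
  also have "\<dots> = 2 * (\<Sum>j\<in>{1..<H}. g j) + g H"
  proof (rule sum_symmetric_even[OF assms])
    fix j assume j: "j \<in> {1..<H}"
    hence "odd (2 * H - j) \<longleftrightarrow> odd j" by auto
    thus "g (2 * H - j) = g j" using sin_pi_reflect(1)[of j "2 * H"] j by (simp add: g_def)
  qed
  also have "g H = of_bool (odd H)" unfolding g_def sin_pi_half_index[OF assms] by simp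
  finally show ?thesis unfolding g_def by simp
qed

lemma half_csc_sec_sum:
  assumes "odd N"
  shows "(\<Sum>j\<in>{1..N div 2}. (1 / sin (pi * real j / real N) ^ 2) ^ q * (1 / cos (pi * real j / real N) ^ 2) ^ p) =
    csc_sec_sum q p N / 2"
proof -
  obtain H where H: "N = 2 * H + 1" using assms by (elim oddE)
  have "csc_sec_sum q p N = 2 * (\<Sum>j\<in>{1..H}. (1 / sin (pi * real j / real N) ^ 2) ^ q * (1 / cos (pi * real j / real N) ^ 2) ^ p)"
    unfolding csc_sec_sum_def H
  proof (rule sum_symmetric_odd)
    fix j assume "j \<in> {1..H}"
    hence "j \<le> 2 * H + 1" "2 * H + 1 > 0" by auto
    note sin_pi_reflect[OF this]
    thus "(1 / sin (pi * real (2 * H + 1 - j) / real (2 * H + 1)) ^ 2) ^ q *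
        (1 / cos (pi * real (2 * H + 1 - j) / real (2 * H + 1)) ^ 2) ^ p =
       (1 / sin (pi * real j / real (2 * H + 1)) ^ 2) ^ q *
        (1 / cos (pi * real j / real (2 * H + 1)) ^ 2) ^ p"
      by (simp only: power2_minus)
  qed
  moreover have "N div 2 = H" using H by simp
  ultimately show ?thesis by simp
qed

section \<open>The character sums for the different types of graph\<close>

lemma sum_even_split:
  fixes t :: nat
  assumes "even t"
  shows "(\<Sum>j\<in>{1..(t + 2) div 2}. (f j :: real)) = (\<Sum>j\<in>{1..<t div 2 + 1}. f j) + f (t div 2 + 1)"
proof -
  have "{1..(t + 2) div 2} = insert (t div 2 + 1) {1..<t div 2 + 1}" by auto
  thus ?thesis by simp
qed

lemma leaf_sum_even_half:
  assumes "even t"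
  shows "leaf_sum t (t div 2 + 1) = of_bool (odd (t div 2 + 1))"
proof -
  have "t + 2 = 2 * (t div 2 + 1)" using assms by simp
  hence "sin (pi * real (t div 2 + 1) / real (t + 2)) = 1"
    by (metis sin_pi_half_index Suc_eq_plus1 zero_less_Suc)
  thus ?thesis using leaf_sum_even[of "t div 2 + 1" t] assms by simp
qed

text \<open>For odd \<open>H\<close> the middle index enters twice: folding removes half of its
  generic value, and its true value is added back. Their mismatch separates the classes modulo
  4.\<close>

lemma state_sum_even_pendant:
  assumes "even t" "n > 0"
  defines "H \<equiv> t div 2 + 1"
  shows "(\<Sum>j\<in>{1..(t + 2) div 2}. character_norm t j ^ q * leaf_sum t j ^ n) =
    (real (t + 2) / 4) ^ q * ((odd_csc_sum (q + n) H - of_bool (odd H)) / 2) +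
    of_bool (odd H) * (real (t + 2) / 2) ^ q"
proof -
  have N: "t + 2 = 2 * H" using assms by simp
  have "(\<Sum>j\<in>{1..<H}. character_norm t j ^ q * leaf_sum t j ^ n) =
      (\<Sum>j\<in>{1..<H}. (real (t + 2) / 4) ^ q * (if odd j then (1 / sin (pi * real j / real (2 * H)) ^ 2) ^ (q + n) else 0))"
  proof (intro sum.cong refl)
    fix j assume j: "j \<in> {1..<H}"
    have h: "character_norm t j = real (t + 2) / 4 * (1 / sin (pi * real j / real (2 * H)) ^ 2)"
      unfolding N[symmetric] using j assms by (intro character_norm_even) auto
    have l: "leaf_sum t j = (if odd j then 1 / sin (pi * real j / real (2 * H)) ^ 2 else 0)"
      unfolding N[symmetric] using j assms by (intro leaf_sum_even) auto
    show "character_norm t j ^ q * leaf_sum t j ^ n =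
        (real (t + 2) / 4) ^ q * (if odd j then (1 / sin (pi * real j / real (2 * H)) ^ 2) ^ (q + n) else 0)"
      unfolding h l power_mult_distrib power_add using \<open>n > 0\<close> by simp
  qed
  also have "\<dots> = (real (t + 2) / 4) ^ q * ((odd_csc_sum (q + n) H - of_bool (odd H)) / 2)"
    unfolding sum_distrib_left[symmetric] by (subst half_odd_csc_sum) (auto simp: H_def)
  finally have "(\<Sum>j\<in>{1..<H}. character_norm t j ^ q * leaf_sum t j ^ n) =
    (real (t + 2) / 4) ^ q * ((odd_csc_sum (q + n) H - of_bool (odd H)) / 2)" .
  moreover have "character_norm t H ^ q * leaf_sum t H ^ n = of_bool (odd H) * (real (t + 2) / 2) ^ q"
    unfolding H_def character_norm_even_half[OF assms(1)] leaf_sum_even_half[OF assms(1)] using \<open>n > 0\<close> by simp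
  ultimately show ?thesis
    unfolding sum_even_split[OF assms(1)] H_def[symmetric] by simp
qed

text \<open>Without leaves the middle index contributes for every even \<open>t\<close>, so its
  correction is itself polynomial and no distinction modulo 4 arises.\<close>

lemma poly_fun_on_state_sum_even_cubic:
  "poly_fun_on {t. even t} (\<lambda>t. \<Sum>j\<in>{1..(t + 2) div 2}. character_norm t j ^ q)"
proof -
  have "(\<Sum>j\<in>{1..(t + 2) div 2}. character_norm t j ^ q) =
      (real (t + 2) / 4) ^ q * ((csc_sum q (t + 2) - 1) / 2) + (real (t + 2) / 2) ^ q" if "even t" for t
  proof -
    define H where "H = t div 2 + 1"
    have N: "t + 2 = 2 * H" using that by (simp add: H_def)
    have "(\<Sum>j\<in>{1..<H}. character_norm t j ^ q) =
        (\<Sum>j\<in>{1..<H}. (real (t + 2) / 4) ^ q * (1 / sin (pi * real j / real (2 * H)) ^ 2) ^ q)"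
    proof (intro sum.cong refl)
      fix j assume j: "j \<in> {1..<H}"
      have h: "character_norm t j = real (t + 2) / 4 * (1 / sin (pi * real j / real (2 * H)) ^ 2)"
        unfolding N[symmetric] using j that by (intro character_norm_even) (auto simp: H_def)
      show "character_norm t j ^ q = (real (t + 2) / 4) ^ q * (1 / sin (pi * real j / real (2 * H)) ^ 2) ^ q"
        unfolding h power_mult_distrib ..
    qed
    also have "\<dots> = (real (t + 2) / 4) ^ q * ((csc_sum q (2 * H) - 1) / 2)"
      unfolding sum_distrib_left[symmetric] by (subst half_csc_sum) (auto simp: H_def)
    finally have half: "(\<Sum>j\<in>{1..<H}. character_norm t j ^ q) =
        (real (t + 2) / 4) ^ q * ((csc_sum q (2 * H) - 1) / 2)" .
    have hH: "character_norm t H = real (t + 2) / 2" unfolding H_def by (rule character_norm_even_half[OF that])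
    show ?thesis unfolding sum_even_split[OF that] H_def[symmetric] half hH by (simp only: N)
  qed
  moreover have "poly_fun_on {t. even t}
      (\<lambda>t. (real (t + 2) / 4) ^ q * ((csc_sum q (t + 2) - 1) / 2) + (real (t + 2) / 2) ^ q)"
    unfolding of_nat_add divide_inverse
    by (intro poly_fun_on_intros poly_fun_on_shift[OF poly_fun_on_csc_sum]) auto
  ultimately show ?thesis by (subst poly_fun_on_cong) auto
qed

text \<open>With exponent -1 the two corrections at the middle index, for odd
  \<open>H = t div 2 + 1\<close>, are \<open>- 1 / H\<close> and \<open>1 / H\<close> and
  cancel.\<close>

lemma poly_fun_on_state_sum_even_tree:
  assumes "n > 0"
  shows "poly_fun_on {t. even t} (\<lambda>t. \<Sum>j\<in>{1..(t + 2) div 2}. leaf_sum t j ^ n / character_norm t j)"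
proof -
  obtain m where m: "n = Suc m" using assms by (cases n) auto
  have "(\<Sum>j\<in>{1..(t + 2) div 2}. leaf_sum t j ^ n / character_norm t j) =
      odd_csc_sum m (t div 2 + 1) / real (t div 2 + 1)" if "even t" for t
  proof -
    define H where "H = t div 2 + 1"
    have N: "t + 2 = 2 * H" and H: "H > 0" using that by (simp_all add: H_def)
    have "(\<Sum>j\<in>{1..<H}. leaf_sum t j ^ n / character_norm t j) =
        (\<Sum>j\<in>{1..<H}. 2 / real H * (if odd j then (1 / sin (pi * real j / real (2 * H)) ^ 2) ^ m else 0))"
    proof (intro sum.cong refl)
      fix j assume j: "j \<in> {1..<H}"
      define c where "c = 1 / sin (pi * real j / real (2 * H)) ^ 2"
      have "sin (pi * real j / real (2 * H)) \<noteq> 0" using j by (intro sin_pi_mult_div_neq_0) auto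
      hence "c \<noteq> 0" by (simp add: c_def)
      have "character_norm t j = real (t + 2) / 4 * c"
        unfolding N[symmetric] c_def using j that by (intro character_norm_even) (auto simp: H_def)
      hence h: "character_norm t j = real H / 2 * c" unfolding N by simp
      have l: "leaf_sum t j = (if odd j then c else 0)"
        unfolding N[symmetric] c_def using j that by (intro leaf_sum_even) (auto simp: H_def)
      show "leaf_sum t j ^ n / character_norm t j = 2 / real H * (if odd j then c ^ m else 0)"
        unfolding h l m using \<open>c \<noteq> 0\<close> by simp
    qed
    also have "\<dots> = 2 / real H * ((odd_csc_sum m H - of_bool (odd H)) / 2)"
      unfolding sum_distrib_left[symmetric] by (subst half_odd_csc_sum) (auto simp: H)
    also have "\<dots> = odd_csc_sum m H / real H - of_bool (odd H) / real H"
      by (simp add: diff_divide_distrib)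
    finally have "(\<Sum>j\<in>{1..<H}. leaf_sum t j ^ n / character_norm t j) = odd_csc_sum m H / real H - of_bool (odd H) / real H" .
    moreover have "real (t + 2) / 2 = real H" unfolding N by simp
    hence hH: "character_norm t H = real H" using character_norm_even_half[OF that] unfolding H_def by (simp only:)
    have lH: "leaf_sum t H = of_bool (odd H)" unfolding H_def by (rule leaf_sum_even_half[OF that])
    have "leaf_sum t H ^ n / character_norm t H = of_bool (odd H) / real H"
      unfolding hH lH using \<open>n > 0\<close> by simp
    ultimately show ?thesis
      unfolding sum_even_split[OF that] H_def[symmetric] by simp
  qed
  moreover have "poly_fun_on {t. even t} (\<lambda>t. odd_csc_sum m (t div 2 + 1) / real (t div 2 + 1))"
    by (rule poly_fun_on_shift_even[OF poly_fun_on_odd_csc_sum_div])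
  ultimately show ?thesis by (subst poly_fun_on_cong) auto
qed

text \<open>The norm carries a squared cosecant and a squared secant, a leaf only a squared secant.
  For odd \<open>t\<close> there is no middle index, so folding is an exact halving.\<close>

lemma poly_fun_on_state_sum_odd:
  "poly_fun_on {t. odd t} (\<lambda>t. \<Sum>j\<in>{1..(t + 2) div 2}. character_norm t j ^ q * leaf_sum t j ^ n)"
proof -
  have "(\<Sum>j\<in>{1..(t + 2) div 2}. character_norm t j ^ q * leaf_sum t j ^ n) =
      (real (t + 2) / 16) ^ q * (1 / 4) ^ n * (csc_sec_sum q (q + n) (t + 2) / 2)" if "odd t" for t
  proof -
    have "odd (t + 2)" using that by simp
    have "(\<Sum>j\<in>{1..(t + 2) div 2}. character_norm t j ^ q * leaf_sum t j ^ n) = (\<Sum>j\<in>{1..(t + 2) div 2}.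
        (real (t + 2) / 16) ^ q * (1 / 4) ^ n * ((1 / sin (pi * real j / real (t + 2)) ^ 2) ^ q *
         (1 / cos (pi * real j / real (t + 2)) ^ 2) ^ (q + n)))"
    proof (intro sum.cong refl)
      fix j assume j: "j \<in> {1..(t + 2) div 2}"
      show "character_norm t j ^ q * leaf_sum t j ^ n =
         (real (t + 2) / 16) ^ q * (1 / 4) ^ n * ((1 / sin (pi * real j / real (t + 2)) ^ 2) ^ q *
         (1 / cos (pi * real j / real (t + 2)) ^ 2) ^ (q + n))"
        unfolding character_norm_odd[OF j that] leaf_sum_odd[OF j that] power_mult_distrib power_add
        by (simp only: mult_ac)
    qed
    thus ?thesis unfolding sum_distrib_left[symmetric] half_csc_sec_sum[OF \<open>odd (t + 2)\<close>] .
  qed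
  moreover have "poly_fun_on {t. odd t}
      (\<lambda>t. (real (t + 2) / 16) ^ q * (1 / 4) ^ n * (csc_sec_sum q (q + n) (t + 2) / 2))"
    unfolding of_nat_add divide_inverse
    by (intro poly_fun_on_intros poly_fun_on_shift[OF poly_fun_on_csc_sec_sum]) auto
  ultimately show ?thesis by (subst poly_fun_on_cong) auto
qed

text \<open>Dividing by the norm multiplies by squared sine and squared cosine; replacing the former
  by 1 minus the latter leaves pure secant sums with exponents \<open>n - 1\<close> and
  \<open>n - 2\<close>, hence the hypothesis.\<close>

lemma poly_fun_on_state_sum_odd_tree:
  assumes "n \<ge> 2"
  shows "poly_fun_on {t. odd t} (\<lambda>t. \<Sum>j\<in>{1..(t + 2) div 2}. leaf_sum t j ^ n / character_norm t j)"
proof -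
  obtain m where m: "n = Suc (Suc m)" using assms by (metis Suc_le_D numeral_2_eq_2 Suc_le_mono)
  have "(\<Sum>j\<in>{1..(t + 2) div 2}. leaf_sum t j ^ n / character_norm t j) =
      16 * (1 / 4) ^ n / 2 * (odd_csc_sum (Suc m) (t + 2) / real (t + 2) - odd_csc_sum m (t + 2) / real (t + 2))"
    if "odd t" for t
  proof -
    have odd: "odd (t + 2)" using that by simp
    have "(\<Sum>j\<in>{1..(t + 2) div 2}. leaf_sum t j ^ n / character_norm t j) = (\<Sum>j\<in>{1..(t + 2) div 2}.
        16 * (1 / 4) ^ n / real (t + 2) *
        ((1 / sin (pi * real j / real (t + 2)) ^ 2) ^ 0 * (1 / cos (pi * real j / real (t + 2)) ^ 2) ^ Suc m -
         (1 / sin (pi * real j / real (t + 2)) ^ 2) ^ 0 * (1 / cos (pi * real j / real (t + 2)) ^ 2) ^ m))"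
    proof (intro sum.cong refl)
      fix j assume j: "j \<in> {1..(t + 2) div 2}"
      define s where "s = sin (pi * real j / real (t + 2)) ^ 2"
      define c where "c = cos (pi * real j / real (t + 2)) ^ 2"
      have sc: "s = 1 - c" by (simp add: s_def c_def sin_squared_eq)
      have "0 < j" "j < t + 2" using j by auto
      hence "c \<noteq> 0" "s \<noteq> 0"
        using sin_pi_mult_div_neq_0[of j "t + 2"] cos_pi_mult_div_odd_neq_0[OF odd, of j]
        by (auto simp: s_def c_def)
      have h: "character_norm t j = real (t + 2) / 16 * ((1 / s) * (1 / c))"
        unfolding s_def c_def by (rule character_norm_odd[OF j that])
      have l: "leaf_sum t j = 1 / 4 * (1 / c)" unfolding c_def by (rule leaf_sum_odd[OF j that])
      have "leaf_sum t j ^ n / character_norm t j = 16 * (1 / 4) ^ n / real (t + 2) * (s * c * (1 / c) ^ n)"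
        unfolding h l power_mult_distrib using \<open>c \<noteq> 0\<close> \<open>s \<noteq> 0\<close> by simp
      also have "s * c * (1 / c) ^ n = (1 / c) ^ Suc m - (1 / c) ^ m"
        unfolding m sc using \<open>c \<noteq> 0\<close> by (simp add: field_simps)
      finally show "leaf_sum t j ^ n / character_norm t j = 16 * (1 / 4) ^ n / real (t + 2) *
          ((1 / s) ^ 0 * (1 / c) ^ Suc m - (1 / s) ^ 0 * (1 / c) ^ m)" by simp
    qed
    also have "\<dots> = 16 * (1 / 4) ^ n / real (t + 2) * (csc_sec_sum 0 (Suc m) (t + 2) / 2 - csc_sec_sum 0 m (t + 2) / 2)"
      unfolding sum_distrib_left[symmetric] sum_subtractf half_csc_sec_sum[OF odd] ..
    \<comment> \<open>The terms 1 from \<open>csc_sec_sum_0\<close> cancel in the difference;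
      divided by \<open>t + 2\<close>, either alone would not be polynomial.\<close>
    also have "\<dots> = 16 * (1 / 4) ^ n / 2 * (odd_csc_sum (Suc m) (t + 2) / real (t + 2) - odd_csc_sum m (t + 2) / real (t + 2))"
    proof -
      have "C / r * ((a - 1) / 2 - (b - 1) / 2) = C / 2 * (a / r - b / r)" for C r a b :: real
        by (cases "r = 0") (simp_all add: field_simps)
      thus ?thesis unfolding csc_sec_sum_0[OF odd] .
    qed
    finally show ?thesis .
  qed
  moreover have "poly_fun_on {t. odd t} (\<lambda>t. 16 * (1 / 4) ^ n / 2 *
      (odd_csc_sum (Suc m) (t + 2) / real (t + 2) - odd_csc_sum m (t + 2) / real (t + 2)))"
    by (intro poly_fun_on_mult poly_fun_on_diff poly_fun_on_const
        poly_fun_on_shift[OF poly_fun_on_odd_csc_sum_div]) auto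
  ultimately show ?thesis by (subst poly_fun_on_cong) auto
qed

section \<open>Periods of quasi-polynomials\<close>

lemma quasi_poly_modulus_iff:
  "quasi_poly_modulus f \<alpha> \<longleftrightarrow> \<alpha> > 0 \<and> (\<forall>j<\<alpha>. poly_fun_on {t. t mod \<alpha> = j} (\<lambda>t. real (f t)))"
proof -
  have "(\<exists>p :: nat \<Rightarrow> real poly. \<forall>j<\<alpha>. \<forall>t. t mod \<alpha> = j \<longrightarrow> real (f t) = poly (p j) (real t)) \<longleftrightarrow>
      (\<forall>j<\<alpha>. poly_fun_on {t. t mod \<alpha> = j} (\<lambda>t. real (f t)))"
    (is "?L \<longleftrightarrow> ?R")
  proof
    assume ?L thus ?R by (auto simp: poly_fun_on_def)
  next
    assume ?R
    hence "\<forall>j. \<exists>p :: real poly. j < \<alpha> \<longrightarrow> (\<forall>t. t mod \<alpha> = j \<longrightarrow> real (f t) = poly p (real t))"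
      by (auto simp: poly_fun_on_def)
    from choice[OF this] show ?L by blast
  qed
  thus ?thesis by (auto simp: quasi_poly_modulus_def)
qed

lemma quasi_poly_modulus_2I:
  assumes "poly_fun_on {t. even t} (\<lambda>t. real (f t))" "poly_fun_on {t. odd t} (\<lambda>t. real (f t))"
  shows "quasi_poly_modulus f 2"
  unfolding quasi_poly_modulus_iff
proof (intro conjI allI impI)
  fix j :: nat assume "j < 2"
  hence "{t :: nat. t mod 2 = j} = {t. even t} \<or> {t :: nat. t mod 2 = j} = {t. odd t}"
    by (cases "j = 0") (auto simp: even_iff_mod_2_eq_zero less_2_cases_iff)
  thus "poly_fun_on {t. t mod 2 = j} (\<lambda>t. real (f t))" by (rule disjE) (simp_all only: assms)
qed simp

text \<open>A nonzero polynomial has finitely many roots. The step 12 is a multiple of 4 and of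
  every candidate period below 4.\<close>

lemma poly_eq_on_progression:
  fixes p q :: "real poly"
  assumes "\<And>k. poly p (real (12 * k + c)) = poly q (real (12 * k + c))"
  shows "p = q"
proof (rule ccontr)
  assume "p \<noteq> q"
  hence "finite {x. poly (p - q) x = 0}" by (intro poly_roots_finite) auto
  moreover have "range (\<lambda>k. real (12 * k + c)) \<subseteq> {x. poly (p - q) x = 0}" using assms by auto
  ultimately have "finite (range (\<lambda>k::nat. real (12 * k + c)))" by (rule finite_subset[rotated])
  moreover have "inj (\<lambda>k::nat. real (12 * k + c))" by (auto simp: inj_def)
  ultimately show False using finite_imageD infinite_UNIV_nat by blast
qed

text \<open>A modulus 1, 2 or 3 divides 6 and so puts \<open>12 * k\<close> and
  \<open>12 * k + 6\<close> into one class; but these are 0 and 2 modulo 4, governed by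
  \<open>p0\<close> and \<open>p2\<close>.\<close>

lemma quasi_period_eq_4:
  assumes odd: "poly_fun_on {t. odd t} (\<lambda>t. real (f t))"
    and p0: "\<And>t. t mod 4 = 0 \<Longrightarrow> real (f t) = poly p0 (real t)"
    and p2: "\<And>t. t mod 4 = 2 \<Longrightarrow> real (f t) = poly p2 (real t)"
    and "p0 \<noteq> p2"
  shows "quasi_poly_modulus f 4" "quasi_period f = 4"
proof -
  show mod4: "quasi_poly_modulus f 4"
    unfolding quasi_poly_modulus_iff
  proof (intro conjI allI impI)
    fix j :: nat assume "j < 4"
    hence "j = 0 \<or> j = 2 \<or> odd j" by presburger
    then consider "j = 0" | "j = 2" | "odd j" by blast
    thus "poly_fun_on {t. t mod 4 = j} (\<lambda>t. real (f t))"
    proof cases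
      case 3
      have "{t. t mod 4 = j} \<subseteq> {t. odd t}" using 3 by (auto simp: dvd_mod_iff)
      thus ?thesis by (rule poly_fun_on_subset[OF odd])
    qed (use p0 p2 in \<open>auto simp: poly_fun_on_def\<close>)
  qed simp
  show "quasi_period f = 4"
    unfolding quasi_period_def
  proof (rule Least_equality[of "quasi_poly_modulus f", OF mod4])
    fix \<alpha> assume \<alpha>: "quasi_poly_modulus f \<alpha>"
    show "4 \<le> \<alpha>"
    proof (rule ccontr)
      assume "\<not> 4 \<le> \<alpha>"
      moreover have "\<alpha> > 0" using \<alpha> by (simp add: quasi_poly_modulus_iff)
      ultimately consider "\<alpha> = 1" | "\<alpha> = 2" | "\<alpha> = 3" by linarith
      hence dvd: "(12 * k) mod \<alpha> = 0" "(12 * k + 6) mod \<alpha> = 0" for k by (cases; presburger)+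
      have "poly_fun_on {t. t mod \<alpha> = 0} (\<lambda>t. real (f t))"
        using \<alpha> by (auto simp: quasi_poly_modulus_iff)
      then obtain p where p: "\<And>t. t mod \<alpha> = 0 \<Longrightarrow> real (f t) = poly p (real t)"
        by (auto simp: poly_fun_on_def)
      have m4: "(12 * k) mod 4 = 0" "(12 * k + 6) mod 4 = 2" for k :: nat by presburger+
      have "poly p (real (12 * k + 0)) = poly p0 (real (12 * k + 0))" for k
        using p[of "12 * k"] p0[of "12 * k"] dvd m4 by simp
      hence "p = p0" by (rule poly_eq_on_progression)
      moreover have "poly p (real (12 * k + 6)) = poly p2 (real (12 * k + 6))" for k
        using p[of "12 * k + 6"] p2[of "12 * k + 6"] dvd m4 by metis
      hence "p = p2" by (rule poly_eq_on_progression)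
      ultimately show False using \<open>p0 \<noteq> p2\<close> by simp
    qed
  qed
qed

lemma quasi_period_le_2:
  assumes "quasi_poly_modulus f 2"
  shows "quasi_polynomial f" "quasi_period f \<le> 2"
  using assms by (auto simp: quasi_polynomial_def quasi_period_def intro: Least_le)

theorem theorem2:
  fixes G :: "('v, 'e) mgraph"
  assumes "one_three_graph G" and "connected_mgraph G"
  shows "quasi_polynomial (ehrhart_P G) \<and>
    (if tree_mgraph G \<or> cubic_graph G then quasi_period (ehrhart_P G) \<le> 2
     else quasi_period (ehrhart_P G) = 4)"
proof (cases "internal_nodes G = {}")
  case True
  note single = no_internal_nodes[OF assms True]
  have "poly_fun_on {t. even t} (\<lambda>t. 1 / 2 * real t + 1)" "poly_fun_on {t. odd t} (\<lambda>t. 1 / 2 * real t + 1 / 2)"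
    by (intro poly_fun_on_intros)+
  hence "quasi_poly_modulus (ehrhart_P G) 2"
    by (intro quasi_poly_modulus_2I; subst poly_fun_on_cong) (auto simp: single(2) field_simps elim!: oddE)
  from quasi_period_le_2[OF this] show ?thesis using single(1) by simp
next
  case False
  define A where "A = card (inner_edges G)"
  define n where "n = card (pendant_edges G)"
  define V where "V = card (internal_nodes G)"
  have E: "real (ehrhart_P G t) =
      (\<Sum>j\<in>{1..(t + 2) div 2}. character_norm t j ^ A * leaf_sum t j ^ n / character_norm t j ^ V)" for t
    unfolding ehrhart_eq_card_labellings[OF assms False] A_def n_def V_def
    by (rule card_labellings_spectral[OF assms False])
  have pos: "character_norm t j \<noteq> 0" if "j \<in> {1..(t + 2) div 2}" for t j
    using character_norm_pos[OF that] by simp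
  show ?thesis
  proof (cases "tree_mgraph G")
    case True
    hence V: "V = Suc A" using tree_dichotomy[OF assms False] by (simp add: A_def V_def)
    \<comment> \<open>Together with \<open>V = A + 1\<close> this gives
      \<open>n = A + 3\<close>.\<close>
    moreover have "3 * V = 2 * A + n" using handshake_internal[OF assms False] by (simp add: A_def V_def n_def)
    ultimately have n: "n \<ge> 2" by simp
    have E': "real (ehrhart_P G t) = (\<Sum>j\<in>{1..(t + 2) div 2}. leaf_sum t j ^ n / character_norm t j)" for t
      unfolding E V by (intro sum.cong refl) (use pos in \<open>simp add: field_simps\<close>)
    have "quasi_poly_modulus (ehrhart_P G) 2"
    proof (rule quasi_poly_modulus_2I)
      show "poly_fun_on {t. even t} (\<lambda>t. real (ehrhart_P G t))"
        unfolding E' using n by (intro poly_fun_on_state_sum_even_tree) simp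
      show "poly_fun_on {t. odd t} (\<lambda>t. real (ehrhart_P G t))"
        unfolding E' by (rule poly_fun_on_state_sum_odd_tree[OF n])
    qed
    from quasi_period_le_2[OF this] show ?thesis using True by simp
  next
    case nontree: False
    then obtain q where q: "A = V + q"
      using tree_dichotomy[OF assms False] by (auto simp: A_def V_def le_iff_add)
    have E': "real (ehrhart_P G t) = (\<Sum>j\<in>{1..(t + 2) div 2}. character_norm t j ^ q * leaf_sum t j ^ n)" for t
      unfolding E q by (intro sum.cong refl) (use pos in \<open>simp add: power_add\<close>)
    have odd: "poly_fun_on {t. odd t} (\<lambda>t. real (ehrhart_P G t))"
      unfolding E' by (rule poly_fun_on_state_sum_odd)
    show ?thesis
    proof (cases "n = 0")
      case True
      have "poly_fun_on {t. even t} (\<lambda>t. real (ehrhart_P G t))"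
        unfolding E' True using poly_fun_on_state_sum_even_cubic[of q] by simp
      from quasi_period_le_2[OF quasi_poly_modulus_2I[OF this odd]]
      show ?thesis using True cubic_iff_no_pendant[OF assms False] by (simp add: n_def)
    next
      case npos: False
      \<comment> \<open>The part common to both even classes modulo 4: the state sum without its
        corrections at the middle index.\<close>
      have "poly_fun_on {t. even t} (\<lambda>t. (real (t + 2) / 4) ^ q * (odd_csc_sum (q + n) (t div 2 + 1) / 2))"
        unfolding of_nat_add divide_inverse
        by (intro poly_fun_on_intros poly_fun_on_shift_even[OF poly_fun_on_odd_csc_sum])
      then obtain p where p: "\<And>t. even t \<Longrightarrow>
          (real (t + 2) / 4) ^ q * (odd_csc_sum (q + n) (t div 2 + 1) / 2) = poly p (real t)"
        by (auto simp: poly_fun_on_def)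
      \<comment> \<open>The net correction for odd \<open>t div 2 + 1\<close>: the true middle term
        minus half of the generic one.\<close>
      define d :: "real poly" where "d = smult ((2 ^ q - 1 / 2) / 4 ^ q) ([:2, 1:] ^ q)"
      have d: "poly d (real t) = (real (t + 2) / 2) ^ q - (real (t + 2) / 4) ^ q / 2" for t
      proof -
        have "real (t + 2) / 2 = 2 * (real (t + 2) / 4)" by (simp add: field_simps)
        hence "(real (t + 2) / 2) ^ q = 2 ^ q * (real (t + 2) / 4) ^ q" by (simp only: power_mult_distrib)
        thus ?thesis by (simp add: d_def power_divide field_simps)
      qed
      \<comment> \<open>Here \<open>q\<close> is a natural number; at exponent -1, the tree case,
        the factor would vanish.\<close>
      have "(2 :: real) ^ q \<ge> 1" by simp
      hence "(2 :: real) ^ q - 1 / 2 \<noteq> 0" by linarith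
      hence "d \<noteq> 0" by (simp add: d_def)
      have E0: "real (ehrhart_P G t) = poly p (real t) + of_bool (odd (t div 2 + 1)) * poly d (real t)"
        if "even t" for t
      proof -
        have "X * ((S - b) / 2) + b * Y = X * (S / 2) + b * (Y - X / 2)" for X Y S b :: real
          by (simp add: field_simps)
        thus ?thesis using npos
          unfolding E' d p[OF that, symmetric] by (subst state_sum_even_pendant[OF that]) auto
      qed
      have p0: "real (ehrhart_P G t) = poly (p + d) (real t)" if "t mod 4 = 0" for t
      proof -
        have "even t" "odd (t div 2 + 1)" using that by presburger+
        thus ?thesis using E0[of t] by simp
      qed
      have p2: "real (ehrhart_P G t) = poly p (real t)" if "t mod 4 = 2" for t
      proof -
        have "even t" "\<not> odd (t div 2 + 1)" using that by presburger+
        thus ?thesis using E0[of t] by simp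
      qed
      have "p + d \<noteq> p" using \<open>d \<noteq> 0\<close> by simp
      from quasi_period_eq_4[OF odd p0 p2 this] show ?thesis
        using nontree npos cubic_iff_no_pendant[OF assms False]
        by (auto simp: quasi_polynomial_def n_def)
    qed
  qed
qed

end
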